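(* Let $G$ and $H$ be (locally compact) étale Hausdorff groupoids. Then the following hold. (1) If $G$ and $H$ are Morita equivalent, then $\mathrm{dad}(G)=\mathrm{dad}(H)$. (2) $\mathrm{dad}(G)=\max_{U\in\mathcal{U}}\mathrm{dad}(G|_U)$ for every finite open cover $\mathcal{U}$ of the unit space $G^0$. (3) $\mathrm{dad}(G\times H)\leq \mathrm{dad}(G)+\mathrm{dad}(H)$.
   Context: All groupoids are locally compact, Hausdorff and étale (the range and source maps $r,s\colon G\to G^0$ are local homeomorphisms), where $G^0$ is the unit space. For $A\subseteq G^0$, the restriction is the subgroupoid $G|_A=\{g\in G\mid s(g),r(g)\in A\}$. For $K\subseteq G$, $\langle K\rangle$ denotes the subgroupoid of $G$ generated by $K$. A subset is relatively compact if its closure is compact. Dynamic asymptotic dimension: for $d\in\mathbb{N}=\{0,1,2,\ldots\}$, $G$ has dynamic asymptotic dimension at most $d$ if for every open relatively compact subset $K\subseteq G$ there is a cover of $s(K)\cup r(K)$ by $d+1$ open sets $U_0,\ldots,U_d\subseteq G^0$ such that for each $0\leq i\leq d$ the groupoid $\langle K\cap G|_{U_i}\rangle$ is relatively compact in $G$. $\mathrm{dad}(G)$ is the smallest such $d$, and $\mathrm{dad}(G)=\infty$ if no such $d$ exists. Morita equivalence: given a surjective local homeomorphism $\psi\colon X\to G^0$ from a locally compact Hausdorff space $X$, the blow-up (ampliation) of $G$ is $G^\psi=\{(x,g,y)\in X\times G\times X\mid \psi(x)=r(g),\ \psi(y)=s(g)\}$ with the relative topology from $X\times G\times X$, multiplication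 $(x,g,y)(y,h,z)=(x,gh,z)$ and inverse $(x,g,y)^{-1}=(y,g^{-1},x)$; it is again an étale groupoid. Two étale groupoids $G$ and $H$ are (Morita) equivalent if there are locally compact Hausdorff spaces $X,Y$ and surjective local homeomorphisms $\psi\colon X\to G^0$, $\varphi\colon Y\to H^0$ such that $G^\psi\cong H^\varphi$ as topological groupoids. $G\times H$ is the product groupoid with the product topology and componentwise operations. *)

theory Defs
  imports "HOL-Analysis.Analysis" "HOL-Library.Extended_Nat"
begin

section \<open>Topological groupoids\<close>

text \<open>
  A groupoid is given by its space of arrows, whose unit space is a subset of the arrows (a unit is
  identified with the identity arrow at it). The operations are total functions; only their values
  on arrows, and those of \<^emph>\<open>gmul\<close> on composable pairs, i.e. pairs \<open>(g, h)\<close> with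
  \<open>gsrc g = grng h\<close>, are meaningful.
\<close>

record 'a groupoid_data =
  gtop :: "'a topology"
  gunits :: "'a set"
  gsrc :: "'a \<Rightarrow> 'a"
  grng :: "'a \<Rightarrow> 'a"
  gmul :: "'a \<Rightarrow> 'a \<Rightarrow> 'a"
  ginv :: "'a \<Rightarrow> 'a"

definition arrows :: "'a groupoid_data \<Rightarrow> 'a set" where
  "arrows G = topspace (gtop G)"

definition unit_space :: "'a groupoid_data \<Rightarrow> 'a topology" where
  "unit_space G = subtopology (gtop G) (gunits G)"

definition composable_pairs :: "'a groupoid_data \<Rightarrow> ('a \<times> 'a) set" where
  "composable_pairs G = {(g, h). g \<in> arrows G \<and> h \<in> arrows G \<and> gsrc G g = grng G h}"

locale topological_groupoid =
  fixes G :: "'a groupoid_data"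
  assumes units_arrows: "gunits G \<subseteq> arrows G"
    and src_unit: "g \<in> arrows G \<Longrightarrow> gsrc G g \<in> gunits G"
    and rng_unit: "g \<in> arrows G \<Longrightarrow> grng G g \<in> gunits G"
    and src_of_unit: "u \<in> gunits G \<Longrightarrow> gsrc G u = u"
    and rng_of_unit: "u \<in> gunits G \<Longrightarrow> grng G u = u"
    and mul_closed: "(g, h) \<in> composable_pairs G \<Longrightarrow> gmul G g h \<in> arrows G"
    and src_mul: "(g, h) \<in> composable_pairs G \<Longrightarrow> gsrc G (gmul G g h) = gsrc G h"
    and rng_mul: "(g, h) \<in> composable_pairs G \<Longrightarrow> grng G (gmul G g h) = grng G g"
    and mul_assoc: "(g, h) \<in> composable_pairs G \<Longrightarrow> (h, k) \<in> composable_pairs G \<Longrightarrow>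
      gmul G (gmul G g h) k = gmul G g (gmul G h k)"
    and left_unit: "g \<in> arrows G \<Longrightarrow> gmul G (grng G g) g = g"
    and right_unit: "g \<in> arrows G \<Longrightarrow> gmul G g (gsrc G g) = g"
    and inv_closed: "g \<in> arrows G \<Longrightarrow> ginv G g \<in> arrows G"
    and src_inv: "g \<in> arrows G \<Longrightarrow> gsrc G (ginv G g) = grng G g"
    and rng_inv: "g \<in> arrows G \<Longrightarrow> grng G (ginv G g) = gsrc G g"
    and left_inv: "g \<in> arrows G \<Longrightarrow> gmul G (ginv G g) g = gsrc G g"
    and right_inv: "g \<in> arrows G \<Longrightarrow> gmul G g (ginv G g) = grng G g"
    and continuous_mul:
      "continuous_map (subtopology (prod_topology (gtop G) (gtop G)) (composable_pairs G)) (gtop G)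
         (\<lambda>(g, h). gmul G g h)"
    and continuous_inv: "continuous_map (gtop G) (gtop G) (ginv G)"

definition local_homeomorphism :: "'a topology \<Rightarrow> 'b topology \<Rightarrow> ('a \<Rightarrow> 'b) \<Rightarrow> bool" where
  "local_homeomorphism X Y f \<longleftrightarrow>
     (\<forall>x\<in>topspace X. \<exists>U. openin X U \<and> x \<in> U \<and> openin Y (f ` U) \<and>
        homeomorphic_map (subtopology X U) (subtopology Y (f ` U)) f)"

locale etale_groupoid = topological_groupoid G for G :: "'a groupoid_data" +
  assumes locally_compact: "locally_compact_space (gtop G)"
    and Hausdorff: "Hausdorff_space (gtop G)"
    and src_local_homeo: "local_homeomorphism (gtop G) (unit_space G) (gsrc G)"
    and rng_local_homeo: "local_homeomorphism (gtop G) (unit_space G) (grng G)"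

section \<open>Restrictions, products and blow-ups\<close>

definition restriction :: "'a groupoid_data \<Rightarrow> 'a set \<Rightarrow> 'a groupoid_data" where
  "restriction G A =
     \<lparr>gtop = subtopology (gtop G) {g. gsrc G g \<in> A \<and> grng G g \<in> A},
      gunits = gunits G \<inter> A,
      gsrc = gsrc G, grng = grng G, gmul = gmul G, ginv = ginv G\<rparr>"

definition product_groupoid ::
    "'a groupoid_data \<Rightarrow> 'b groupoid_data \<Rightarrow> ('a \<times> 'b) groupoid_data" where
  "product_groupoid G H =
     \<lparr>gtop = prod_topology (gtop G) (gtop H),
      gunits = gunits G \<times> gunits H,
      gsrc = (\<lambda>(g, h). (gsrc G g, gsrc H h)),
      grng = (\<lambda>(g, h). (grng G g, grng H h)),
      gmul = (\<lambda>(g, h) (g', h'). (gmul G g g', gmul H h h')),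
      ginv = (\<lambda>(g, h). (ginv G g, ginv H h))\<rparr>"

text \<open>
  The unit space of the blow-up of \<open>G\<close> along \<open>\<psi> : X \<rightarrow> gunits G\<close> is the diagonal copy
  \<open>{(x, \<psi> x, x) | x \<in> X}\<close> of \<open>X\<close>.
\<close>

definition blow_up ::
    "'a groupoid_data \<Rightarrow> 'x topology \<Rightarrow> ('x \<Rightarrow> 'a) \<Rightarrow> ('x \<times> 'a \<times> 'x) groupoid_data" where
  "blow_up G X \<psi> =
     \<lparr>gtop = subtopology (prod_topology X (prod_topology (gtop G) X))
               {(x, g, y). \<psi> x = grng G g \<and> \<psi> y = gsrc G g},
      gunits = (\<lambda>x. (x, \<psi> x, x)) ` topspace X,
      gsrc = (\<lambda>(x, g, y). (y, \<psi> y, y)),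
      grng = (\<lambda>(x, g, y). (x, \<psi> x, x)),
      gmul = (\<lambda>(x, g, y) (y', h, z). (x, gmul G g h, z)),
      ginv = (\<lambda>(x, g, y). (y, ginv G g, x))\<rparr>"

section \<open>Morita equivalence\<close>

text \<open>
  Preservation of units and inverses, and the homomorphism property of the inverse map, follow
  from the conditions below.
\<close>

definition topological_groupoid_iso ::
    "'a groupoid_data \<Rightarrow> 'b groupoid_data \<Rightarrow> ('a \<Rightarrow> 'b) \<Rightarrow> bool" where
  "topological_groupoid_iso G H f \<longleftrightarrow>
     homeomorphic_map (gtop G) (gtop H) f \<and>
     (\<forall>g\<in>arrows G. gsrc H (f g) = f (gsrc G g) \<and> grng H (f g) = f (grng G g)) \<and>
     (\<forall>(g, h)\<in>composable_pairs G. f (gmul G g h) = gmul H (f g) (f h))"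

definition surjective_local_homeomorphism ::
    "'a topology \<Rightarrow> 'b topology \<Rightarrow> ('a \<Rightarrow> 'b) \<Rightarrow> bool" where
  "surjective_local_homeomorphism X Y f \<longleftrightarrow>
     local_homeomorphism X Y f \<and> f ` topspace X = topspace Y"

text \<open>
  HOL cannot quantify existentially over the underlying types of the spaces \<open>X\<close> and \<open>Y\<close>, so these
  types are parameters. A theorem that assumes Morita equivalence and leaves \<open>'x\<close> and \<open>'y\<close> free
  covers spaces \<open>X\<close> and \<open>Y\<close> over arbitrary types.
\<close>

definition morita_equivalent ::
    "'x itself \<Rightarrow> 'y itself \<Rightarrow> 'a groupoid_data \<Rightarrow> 'b groupoid_data \<Rightarrow> bool" where
  "morita_equivalent (_ :: 'x itself) (_ :: 'y itself) G H \<longleftrightarrow>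
     (\<exists>(X :: 'x topology) (Y :: 'y topology) \<psi> \<phi> f.
        locally_compact_space X \<and> Hausdorff_space X \<and>
        locally_compact_space Y \<and> Hausdorff_space Y \<and>
        surjective_local_homeomorphism X (unit_space G) \<psi> \<and>
        surjective_local_homeomorphism Y (unit_space H) \<phi> \<and>
        topological_groupoid_iso (blow_up G X \<psi>) (blow_up H Y \<phi>) f)"

section \<open>Dynamic asymptotic dimension\<close>

definition relatively_compact :: "'a topology \<Rightarrow> 'a set \<Rightarrow> bool" where
  "relatively_compact X S \<longleftrightarrow> S \<subseteq> topspace X \<and> compactin X (X closure_of S)"

text \<open>
  Subgroupoids need not contain all units. Closure under source and range is automatic, since
  \<open>gsrc g\<close> is the product of \<open>ginv g\<close> and \<open>g\<close>.
\<close>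

definition subgroupoid :: "'a groupoid_data \<Rightarrow> 'a set \<Rightarrow> bool" where
  "subgroupoid G S \<longleftrightarrow>
     S \<subseteq> arrows G \<and>
     (\<forall>g\<in>S. ginv G g \<in> S) \<and>
     (\<forall>g\<in>S. \<forall>h\<in>S. (g, h) \<in> composable_pairs G \<longrightarrow> gmul G g h \<in> S)"

definition generated_subgroupoid :: "'a groupoid_data \<Rightarrow> 'a set \<Rightarrow> 'a set" where
  "generated_subgroupoid G K = subgroupoid G hull K"

definition dad_at_most :: "'a groupoid_data \<Rightarrow> nat \<Rightarrow> bool" where
  "dad_at_most G d \<longleftrightarrow>
     (\<forall>K. openin (gtop G) K \<and> relatively_compact (gtop G) K \<longrightarrow>
        (\<exists>U :: nat \<Rightarrow> 'a set.
           (\<forall>i\<le>d. openin (unit_space G) (U i)) \<and>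
           gsrc G ` K \<union> grng G ` K \<subseteq> (\<Union>i\<le>d. U i) \<and>
           (\<forall>i\<le>d. relatively_compact (gtop G)
              (generated_subgroupoid G (K \<inter> arrows (restriction G (U i)))))))"

definition dad :: "'a groupoid_data \<Rightarrow> enat" where
  "dad G = (if \<exists>d. dad_at_most G d then enat (LEAST d. dad_at_most G d) else \<infinity>)"

end

theory Submission
  imports Defs
begin

text \<open>
  The three statements become elementary once dynamic asymptotic dimension is expressed by compact
  sets instead of open ones. Call a set \<open>A\<close> of units tame for a set \<open>K\<close> of arrows if the subgroupoid
  generated by the arrows of \<open>K\<close> with source and range in \<open>A\<close> lies in a compact set, and say that a
  compact set \<open>A\<close> of units has dimension at most \<open>d\<close> if for every compact \<open>K\<close> it is a union of
  \<open>d + 1\<close> compact sets tame for \<open>K\<close>. For an open set \<open>U\<close> of units, the restriction to \<open>U\<close> has dynamic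
  asymptotic dimension at most \<open>d\<close> iff all compact subsets of \<open>U\<close> have dimension at most \<open>d\<close>
  (\<open>dad_at_most_restriction_iff\<close>). Passing from open to compact sets is a matter of shrinking a cover.
  The other direction needs every compact tame set to have an open tame neighbourhood
  (\<open>tame_open_enlargement\<close>), and this is where the local injectivity of the range map enters: a compact
  set of arrows is covered by some number \<open>N\<close> of sets on which the range map is injective, so that an
  element of the generated subgroupoid is reached in at most \<open>N\<close> steps, and walks of bounded length
  depend semicontinuously on the allowed set of units.

  The dimension of compact sets is easily seen to have two permanence properties. It does not
  increase under finite unions (\<open>dad_over_Un\<close>): if \<open>A\<close> is covered for \<open>K\<close> by sets \<open>A\<^sub>i\<close> and \<open>B\<close> is covered
  by sets \<open>B\<^sub>i\<close> for the larger set \<open>K'\<close> of arrows that join two points by an excursion through some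
  \<open>A\<^sub>i\<close>, then \<open>A\<^sub>i \<union> B\<^sub>i\<close> is tame for \<open>K\<close>. It can also be pulled back along proper continuous
  homomorphisms defined over a compact set (\<open>dad_over_pullback\<close>).

  Statement (2) follows because a compact set of units is a finite union of compact sets, each inside
  one member of the open cover. For (1), the unit space of \<open>H\<close> is covered by open sets over which the
  local homeomorphism onto it has a section. Over a compact subset of such a set, a section lifts the
  arrows of \<open>H\<close> to its blow-up, hence to that of \<open>G\<close> and from there to \<open>G\<close>; this is a proper
  homomorphism, so the dimension is pulled back, and unions do the rest. For (3), Kolmogorov's
  trick (\<open>dad_over_multiplicity\<close>) turns \<open>d + 1\<close> covering sets into \<open>k + 1\<close> sets of which every point
  lies in at least \<open>k + 1 - d\<close>. With \<open>k = m + n\<close> such families \<open>U\<^sub>i\<close> for \<open>G\<close> and \<open>V\<^sub>i\<close> for \<open>H\<close>, where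
  \<open>m\<close> and \<open>n\<close> are the two dimensions, the pigeonhole principle shows that the \<open>m + n + 1\<close> products
  \<open>U\<^sub>i \<times> V\<^sub>i\<close> already cover.
\<close>

section \<open>Compact Hausdorff spaces\<close>

lemma relatively_compact_iff_subset_compact:
  assumes "Hausdorff_space X"
  shows "relatively_compact X S \<longleftrightarrow> (\<exists>C. compactin X C \<and> S \<subseteq> C)"
proof
  assume "relatively_compact X S"
  then show "\<exists>C. compactin X C \<and> S \<subseteq> C"
    unfolding relatively_compact_def using closure_of_subset by blast
next
  assume "\<exists>C. compactin X C \<and> S \<subseteq> C"
  then obtain C where C: "compactin X C" "S \<subseteq> C" by blast
  then have "closedin X C" using assms compactin_imp_closedin by blast
  with C show "relatively_compact X S"
    unfolding relatively_compact_def
    by (meson closed_compactin closedin_closure_of closure_of_minimal compactin_subset_topspace subset_trans)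
qed

lemma compact_Hausdorff_open_cover_closed_refinement:
  assumes "compact_space X" "Hausdorff_space X"
    and "\<And>V. V \<in> \<O> \<Longrightarrow> openin X V" and "topspace X \<subseteq> \<Union>\<O>"
  obtains \<C> where "finite \<C>" "\<Union>\<C> = topspace X"
    and "\<And>C. C \<in> \<C> \<Longrightarrow> closedin X C \<and> (\<exists>W\<in>\<O>. C \<subseteq> W)"
proof -
  have reg: "neighbourhood_base_of (closedin X) X"
    using assms(1,2) compact_Hausdorff_imp_regular_space neighbourhood_base_of_closedin by blast
  have "\<exists>V C. openin X V \<and> closedin X C \<and> x \<in> V \<and> V \<subseteq> C \<and> (\<exists>W\<in>\<O>. C \<subseteq> W)"
    if x: "x \<in> topspace X" for x
  proof -
    obtain W where "W \<in> \<O>" "x \<in> W" using assms(4) x by blast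
    then show ?thesis
      using reg assms(3) unfolding neighbourhood_base_of by (metis (no_types, lifting))
  qed
  then obtain V C where VC: "\<And>x. x \<in> topspace X \<Longrightarrow>
      openin X (V x) \<and> closedin X (C x) \<and> x \<in> V x \<and> V x \<subseteq> C x \<and> (\<exists>W\<in>\<O>. C x \<subseteq> W)"
    by metis
  have "compactin X (topspace X)" using assms(1) by (simp add: compact_space_def)
  moreover have "\<And>U. U \<in> V ` topspace X \<Longrightarrow> openin X U" using VC by blast
  moreover have "topspace X \<subseteq> \<Union>(V ` topspace X)" using VC by blast
  ultimately obtain \<F> where F: "finite \<F>" "\<F> \<subseteq> V ` topspace X" "topspace X \<subseteq> \<Union>\<F>"
    unfolding compactin_def by meson
  then obtain T where T: "finite T" "T \<subseteq> topspace X" "\<F> = V ` T"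
    by (meson finite_subset_image)
  show thesis
  proof (rule that[of "C ` T"])
    show "finite (C ` T)" using T by blast
    show "\<Union>(C ` T) = topspace X"
    proof
      show "\<Union>(C ` T) \<subseteq> topspace X" using T(2) VC closedin_subset by blast
      show "topspace X \<subseteq> \<Union>(C ` T)"
      proof
        fix x assume "x \<in> topspace X"
        then obtain t where "t \<in> T" "x \<in> V t" using F(3) T(3) by blast
        then show "x \<in> \<Union>(C ` T)" using T(2) VC by blast
      qed
    qed
    show "closedin X D \<and> (\<exists>W\<in>\<O>. D \<subseteq> W)" if "D \<in> C ` T" for D
      using that T VC by blast
  qed
qed

lemma compactin_open_cover_compact_refinement:
  assumes "Hausdorff_space X" "compactin X A"
    and "\<And>V. V \<in> \<O> \<Longrightarrow> openin (subtopology X A) (A \<inter> V)" and "A \<subseteq> \<Union>\<O>"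
  obtains \<C> where "finite \<C>" "\<Union>\<C> = A"
    and "\<And>C. C \<in> \<C> \<Longrightarrow> compactin X C \<and> (\<exists>W\<in>\<O>. C \<subseteq> W)"
proof -
  have A: "topspace (subtopology X A) = A"
    using compactin_subset_topspace[OF assms(2)] by auto
  obtain \<C> where C: "finite \<C>" "\<Union>\<C> = topspace (subtopology X A)"
    "\<And>C. C \<in> \<C> \<Longrightarrow> closedin (subtopology X A) C \<and> (\<exists>W\<in>(\<inter>) A ` \<O>. C \<subseteq> W)"
  proof (rule compact_Hausdorff_open_cover_closed_refinement[of "subtopology X A" "(\<inter>) A ` \<O>"])
    show "compact_space (subtopology X A)" using assms(2) compact_space_subtopology by blast
    show "Hausdorff_space (subtopology X A)" using assms(1) Hausdorff_space_subtopology by blast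
    show "openin (subtopology X A) W" if "W \<in> (\<inter>) A ` \<O>" for W using that assms(3) by blast
    show "topspace (subtopology X A) \<subseteq> \<Union> ((\<inter>) A ` \<O>)" using assms(4) A by auto
  qed blast
  show thesis
  proof (rule that[of \<C>])
    show "compactin X C \<and> (\<exists>W\<in>\<O>. C \<subseteq> W)" if "C \<in> \<C>" for C
    proof -
      have "closedin (subtopology X A) C" using C(3) that by blast
      then have "compactin (subtopology X A) C"
        using assms(2) by (meson closedin_compact_space compact_space_subtopology)
      then show ?thesis using C(3)[OF that] by (auto simp: compactin_subtopology)
    qed
  qed (use C A in auto)
qed

text \<open>
  The witness \<open>y\<close> makes the shrinking preserve multiplicities: \<open>x\<close> lies in at least as many of the sets
  \<open>B i\<close> as some point \<open>y\<close> lies in sets \<open>U i\<close>. Around \<open>y\<close> one uses the intersection of all \<open>U i\<close> that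
  contain it.
\<close>

lemma compactin_open_family_shrinking:
  assumes "Hausdorff_space X" "compactin X A" "finite I"
    and "\<And>i. i \<in> I \<Longrightarrow> openin (subtopology X A) (A \<inter> U i)"
    and "\<And>x. x \<in> A \<Longrightarrow> \<exists>i\<in>I. x \<in> U i"
  obtains B where "\<And>i. compactin X (B i) \<and> B i \<subseteq> A \<inter> U i"
    and "\<And>x. x \<in> A \<Longrightarrow> \<exists>y\<in>A. \<forall>i\<in>I. y \<in> U i \<longrightarrow> x \<in> B i"
proof -
  define N where "N y = (\<Inter>i\<in>{i\<in>I. y \<in> U i}. U i)" for y
  obtain \<C> where C: "finite \<C>" "\<Union>\<C> = A" "\<And>C. C \<in> \<C> \<Longrightarrow> compactin X C \<and> (\<exists>V\<in>N ` A. C \<subseteq> V)"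
  proof (rule compactin_open_cover_compact_refinement[OF assms(1,2), of "N ` A"])
    show "openin (subtopology X A) (A \<inter> V)" if "V \<in> N ` A" for V
    proof -
      obtain y where y: "y \<in> A" "V = N y" using \<open>V \<in> N ` A\<close> by blast
      have "A \<inter> N y = (\<Inter>i\<in>{i\<in>I. y \<in> U i}. A \<inter> U i)"
        unfolding N_def using assms(5)[OF y(1)] by auto
      also have "openin (subtopology X A) \<dots>"
        using assms(3,4,5) y(1) by (intro openin_Inter) auto
      finally show ?thesis using y by simp
    qed
    show "A \<subseteq> \<Union>(N ` A)" unfolding N_def by auto
  qed blast
  show thesis
  proof (rule that[of "\<lambda>i. \<Union>{C\<in>\<C>. C \<subseteq> U i}"])
    show "compactin X (\<Union>{C\<in>\<C>. C \<subseteq> U i}) \<and> \<Union>{C\<in>\<C>. C \<subseteq> U i} \<subseteq> A \<inter> U i" for i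
    proof
      show "compactin X (\<Union>{C\<in>\<C>. C \<subseteq> U i})"
        by (rule compactin_Union) (use C in auto)
      show "\<Union>{C\<in>\<C>. C \<subseteq> U i} \<subseteq> A \<inter> U i" using C(2) by blast
    qed
    show "\<exists>y\<in>A. \<forall>i\<in>I. y \<in> U i \<longrightarrow> x \<in> \<Union>{C\<in>\<C>. C \<subseteq> U i}" if "x \<in> A" for x
    proof -
      from that C(2) obtain c where c: "c \<in> \<C>" "x \<in> c" by blast
      then obtain y where "y \<in> A" "c \<subseteq> N y" using C(3) by blast
      then show ?thesis using c unfolding N_def by blast
    qed
  qed
qed

section \<open>Arrows and generated subgroupoids\<close>

definition over :: "'a groupoid_data \<Rightarrow> 'a set \<Rightarrow> 'a set \<Rightarrow> 'a set" where
  "over G K A = {g \<in> K. gsrc G g \<in> A \<and> grng G g \<in> A}"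

definition prods :: "'a groupoid_data \<Rightarrow> 'a set \<Rightarrow> 'a set \<Rightarrow> 'a set" where
  "prods G S T = {gmul G g h | g h. g \<in> S \<and> h \<in> T \<and> gsrc G g = grng G h}"

lemma over_mono: "K \<subseteq> K' \<Longrightarrow> A \<subseteq> A' \<Longrightarrow> over G K A \<subseteq> over G K' A'"
  by (auto simp: over_def)

lemma prods_mono: "S \<subseteq> S' \<Longrightarrow> T \<subseteq> T' \<Longrightarrow> prods G S T \<subseteq> prods G S' T'"
  unfolding prods_def by blast

lemma prodsI: "g \<in> S \<Longrightarrow> h \<in> T \<Longrightarrow> gsrc G g = grng G h \<Longrightarrow> gmul G g h \<in> prods G S T"
  unfolding prods_def by blast

context topological_groupoid
begin

lemma composable: "(g, h) \<in> composable_pairs G \<longleftrightarrow> g \<in> arrows G \<and> h \<in> arrows G \<and> gsrc G g = grng G h"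
  by (simp add: composable_pairs_def)

lemma unit_arrow: "u \<in> gunits G \<Longrightarrow> u \<in> arrows G"
  using units_arrows by blast

lemma mul_simps [simp]:
  assumes "g \<in> arrows G" "h \<in> arrows G" "gsrc G g = grng G h"
  shows "gmul G g h \<in> arrows G" "gsrc G (gmul G g h) = gsrc G h" "grng G (gmul G g h) = grng G g"
  using assms mul_closed src_mul rng_mul composable by auto

lemma assoc:
  assumes "g \<in> arrows G" "h \<in> arrows G" "k \<in> arrows G" "gsrc G g = grng G h" "gsrc G h = grng G k"
  shows "gmul G (gmul G g h) k = gmul G g (gmul G h k)"
  using assms mul_assoc composable by auto

lemmas inv_simps [simp] = inv_closed src_inv rng_inv left_inv right_inv
lemmas unit_simps [simp] = src_unit rng_unit src_of_unit rng_of_unit left_unit right_unit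

lemma unit_mul [simp]:
  "u \<in> gunits G \<Longrightarrow> g \<in> arrows G \<Longrightarrow> u = grng G g \<Longrightarrow> gmul G u g = g"
  "u \<in> gunits G \<Longrightarrow> g \<in> arrows G \<Longrightarrow> gsrc G g = u \<Longrightarrow> gmul G g u = g"
  by auto

lemma cancel_left [simp]:
  "g \<in> arrows G \<Longrightarrow> h \<in> arrows G \<Longrightarrow> gsrc G g = grng G h \<Longrightarrow> gmul G (ginv G g) (gmul G g h) = h"
  "g \<in> arrows G \<Longrightarrow> h \<in> arrows G \<Longrightarrow> grng G g = grng G h \<Longrightarrow> gmul G g (gmul G (ginv G g) h) = h"
  by (simp_all flip: assoc)

lemma inverse_unique:
  assumes "g \<in> arrows G" "h \<in> arrows G" "gsrc G h = grng G g" "gmul G h g = gsrc G g"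
  shows "h = ginv G g"
proof -
  have "h = gmul G h (gmul G g (ginv G g))" using assms by simp
  also have "\<dots> = gmul G (gmul G h g) (ginv G g)" using assms by (subst assoc) auto
  also have "\<dots> = ginv G g" using assms by simp
  finally show ?thesis .
qed

lemma inv_inv [simp]: "g \<in> arrows G \<Longrightarrow> ginv G (ginv G g) = g"
  using inverse_unique[of "ginv G g" g] by simp

lemma inv_of_unit [simp]: "u \<in> gunits G \<Longrightarrow> ginv G u = u"
  using inverse_unique[of u u] unit_arrow by auto

lemma inv_mul [simp]:
  assumes "g \<in> arrows G" "h \<in> arrows G" "gsrc G g = grng G h"
  shows "ginv G (gmul G g h) = gmul G (ginv G h) (ginv G g)"
  by (rule inverse_unique[symmetric]) (use assms in \<open>simp_all add: assoc\<close>)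

lemma subgroupoidI:
  assumes "S \<subseteq> arrows G" "\<And>g. g \<in> S \<Longrightarrow> ginv G g \<in> S"
    and "\<And>g h. g \<in> S \<Longrightarrow> h \<in> S \<Longrightarrow> gsrc G g = grng G h \<Longrightarrow> gmul G g h \<in> S"
  shows "subgroupoid G S"
  using assms unfolding subgroupoid_def composable by blast

lemma subgroupoidD:
  assumes "subgroupoid G S"
  shows "S \<subseteq> arrows G" "g \<in> S \<Longrightarrow> g \<in> arrows G" "g \<in> S \<Longrightarrow> ginv G g \<in> S"
    and "g \<in> S \<Longrightarrow> h \<in> S \<Longrightarrow> gsrc G g = grng G h \<Longrightarrow> gmul G g h \<in> S"
  using assms unfolding subgroupoid_def composable by blast+

lemma subgroupoid_units:
  assumes "subgroupoid G S" "g \<in> S"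
  shows "gsrc G g \<in> S" "grng G g \<in> S"
  using subgroupoidD[OF assms(1)] assms(2) by (metis inv_simps)+

lemma subgroupoid_over: "subgroupoid G (over G (arrows G) A)"
  by (rule subgroupoidI) (auto simp: over_def)

lemma generated_least: "subgroupoid G T \<Longrightarrow> S \<subseteq> T \<Longrightarrow> generated_subgroupoid G S \<subseteq> T"
  unfolding generated_subgroupoid_def by (rule hull_minimal)

lemma generated_superset: "S \<subseteq> generated_subgroupoid G S"
  unfolding generated_subgroupoid_def by (rule hull_subset)

lemma generated_mono: "S \<subseteq> T \<Longrightarrow> generated_subgroupoid G S \<subseteq> generated_subgroupoid G T"
  unfolding generated_subgroupoid_def by (rule hull_mono)

lemma subgroupoid_generated:
  assumes "S \<subseteq> arrows G"
  shows "subgroupoid G (generated_subgroupoid G S)"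
proof -
  have "subgroupoid G (arrows G)" by (rule subgroupoidI) auto
  with assms have "generated_subgroupoid G S \<subseteq> arrows G"
    using generated_least by blast
  then show ?thesis
    unfolding generated_subgroupoid_def hull_def subgroupoid_def by blast
qed

text \<open>
  Products and inverses create no new sources or ranges.
\<close>

lemma generated_over_units:
  assumes "S \<subseteq> arrows G" "g \<in> generated_subgroupoid G (over G S A)"
  shows "g \<in> arrows G" "gsrc G g \<in> A" "grng G g \<in> A"
proof -
  have "generated_subgroupoid G (over G S A) \<subseteq> over G (arrows G) A"
    by (rule generated_least[OF subgroupoid_over over_mono]) (use assms in auto)
  with assms(2) show "g \<in> arrows G" "gsrc G g \<in> A" "grng G g \<in> A" by (auto simp: over_def)
qed

lemma prods_arrows: "S \<subseteq> arrows G \<Longrightarrow> T \<subseteq> arrows G \<Longrightarrow> prods G S T \<subseteq> arrows G"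
  unfolding prods_def using mul_simps(1) by blast

end

section \<open>Compact sets of arrows\<close>

context topological_groupoid
begin

lemma continuous_src: "continuous_map (gtop G) (gtop G) (gsrc G)"
proof -
  have "continuous_map (gtop G) (subtopology (prod_topology (gtop G) (gtop G)) (composable_pairs G))
      (\<lambda>g. (ginv G g, g))"
    by (auto simp: continuous_map_in_subtopology continuous_map_paired continuous_inv composable
        arrows_def[symmetric])
  from continuous_map_compose[OF this continuous_mul]
  show ?thesis
    by (rule continuous_map_eq) (auto simp: arrows_def[symmetric])
qed

lemma continuous_rng: "continuous_map (gtop G) (gtop G) (grng G)"
  by (rule continuous_map_eq[OF continuous_map_compose[OF continuous_inv continuous_src]])
    (auto simp: arrows_def[symmetric])

lemma closedin_over:
  assumes "closedin (gtop G) V"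
  shows "closedin (gtop G) (over G (arrows G) V)"
proof -
  have "over G (arrows G) V = {g \<in> topspace (gtop G). gsrc G g \<in> V} \<inter> {g \<in> topspace (gtop G). grng G g \<in> V}"
    by (auto simp: over_def arrows_def)
  then show ?thesis
    using closedin_continuous_map_preimage[OF continuous_src assms]
      closedin_continuous_map_preimage[OF continuous_rng assms] by auto
qed

lemma openin_over:
  assumes "openin (unit_space G) U"
  shows "openin (gtop G) (over G (arrows G) U)"
proof -
  obtain W where O: "openin (gtop G) W" "U = W \<inter> gunits G"
    using assms unfolding unit_space_def openin_subtopology by blast
  then have "over G (arrows G) U = {g \<in> topspace (gtop G). gsrc G g \<in> W} \<inter> {g \<in> topspace (gtop G). grng G g \<in> W}"
    by (auto simp: over_def arrows_def[symmetric])
  then show ?thesis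
    using openin_continuous_map_preimage[OF continuous_src O(1)]
      openin_continuous_map_preimage[OF continuous_rng O(1)] by auto
qed

lemma over_eq: "K \<subseteq> arrows G \<Longrightarrow> over G K V = over G (arrows G) V \<inter> K"
  by (auto simp: over_def)

lemma compactin_arrows: "compactin (gtop G) K \<Longrightarrow> K \<subseteq> arrows G"
  by (simp add: arrows_def compactin_subset_topspace)

lemma compactin_inverses: "compactin (gtop G) K \<Longrightarrow> compactin (gtop G) (ginv G ` K)"
  using continuous_inv image_compactin by blast

lemma compactin_sources: "compactin (gtop G) K \<Longrightarrow> compactin (gtop G) (gsrc G ` K)"
  using continuous_src image_compactin by blast

lemma compactin_ranges: "compactin (gtop G) K \<Longrightarrow> compactin (gtop G) (grng G ` K)"
  using continuous_rng image_compactin by blast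

end

locale Hausdorff_groupoid = topological_groupoid +
  assumes Hausdorff_arrows: "Hausdorff_space (gtop G)"
begin

lemma compactin_over:
  assumes "compactin (gtop G) K" "compactin (gtop G) V"
  shows "compactin (gtop G) (over G K V)"
proof -
  have "closedin (gtop G) (over G (arrows G) V)"
    using closedin_over assms(2) Hausdorff_arrows compactin_imp_closedin by blast
  then show ?thesis
    using assms(1) over_eq[of K V] compactin_arrows closed_Int_compactin by metis
qed

lemma closedin_composable:
  "closedin (prod_topology (gtop G) (gtop G)) (composable_pairs G)"
proof -
  have "closedin (prod_topology (gtop G) (gtop G))
      {p \<in> topspace (prod_topology (gtop G) (gtop G)). (gsrc G \<circ> fst) p = (grng G \<circ> snd) p}"
    by (intro closedin_continuous_maps_eq[OF Hausdorff_arrows] continuous_map_compose[OF _ continuous_src]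
        continuous_map_compose[OF _ continuous_rng] continuous_map_fst continuous_map_snd)
  also have "{p \<in> topspace (prod_topology (gtop G) (gtop G)). (gsrc G \<circ> fst) p = (grng G \<circ> snd) p}
      = composable_pairs G"
    by (auto simp: composable arrows_def)
  finally show ?thesis .
qed

lemma compactin_prods:
  assumes "compactin (gtop G) C" "compactin (gtop G) D"
  shows "compactin (gtop G) (prods G C D)"
proof -
  have "compactin (prod_topology (gtop G) (gtop G)) (composable_pairs G \<inter> (C \<times> D))"
    using assms closedin_composable by (intro closed_Int_compactin) (auto simp: compactin_Times)
  then have "compactin (subtopology (prod_topology (gtop G) (gtop G)) (composable_pairs G)) (composable_pairs G \<inter> (C \<times> D))"
    by (simp add: compactin_subtopology)
  from image_compactin[OF this continuous_mul]
  have "compactin (gtop G) ((\<lambda>(g, h). gmul G g h) ` (composable_pairs G \<inter> (C \<times> D)))" .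
  also have "(\<lambda>(g, h). gmul G g h) ` (composable_pairs G \<inter> (C \<times> D)) = prods G C D"
    using compactin_arrows[OF assms(1)] compactin_arrows[OF assms(2)]
    by (force simp: prods_def composable image_iff)
  finally show ?thesis .
qed

end

sublocale etale_groupoid \<subseteq> Hausdorff_groupoid
  by unfold_locales (rule Hausdorff)

section \<open>Tame sets of units\<close>

definition tame :: "'a groupoid_data \<Rightarrow> 'a set \<Rightarrow> 'a set \<Rightarrow> bool" where
  "tame G K A \<longleftrightarrow> (\<exists>C. compactin (gtop G) C \<and> generated_subgroupoid G (over G K A) \<subseteq> C)"

text \<open>
  Bounding the length of walks has two advantages over the generated subgroupoid: for compact \<open>K\<close> and
  \<open>A\<close> the walks form a compact set, and they do not spread far when \<open>A\<close> is enlarged slightly. Length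
  zero gives the units in \<open>A\<close>.
\<close>

primrec walks :: "'a groupoid_data \<Rightarrow> 'a set \<Rightarrow> 'a set \<Rightarrow> nat \<Rightarrow> 'a set" where
  "walks G K A 0 = A"
| "walks G K A (Suc n) = walks G K A n \<union> prods G (walks G K A n) (over G K A)"

lemma walks_mono: "A \<subseteq> B \<Longrightarrow> walks G K A n \<subseteq> walks G K B n"
proof (induction n)
  case (Suc n)
  then have "prods G (walks G K A n) (over G K A) \<subseteq> prods G (walks G K B n) (over G K B)"
    using over_mono[of K K A B G] by (intro prods_mono) auto
  then show ?case using Suc by auto
qed simp

lemma walks_increasing: "m \<le> n \<Longrightarrow> walks G K A m \<subseteq> walks G K A n"
  by (rule lift_Suc_mono_le[of "walks G K A"]) auto

context topological_groupoid
begin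

lemma tame_mono: "tame G K' A' \<Longrightarrow> K \<subseteq> K' \<Longrightarrow> A \<subseteq> A' \<Longrightarrow> tame G K A"
  unfolding tame_def using generated_mono[OF over_mono, of K K' A A'] by blast

lemma over_arrows: "K \<subseteq> arrows G \<Longrightarrow> over G K A \<subseteq> arrows G"
  by (auto simp: over_def)

lemma walks_arrows:
  assumes "K \<subseteq> arrows G" "A \<subseteq> gunits G"
  shows "walks G K A n \<subseteq> arrows G"
proof (induction n)
  case 0
  then show ?case using assms(2) units_arrows by auto
next
  case (Suc n)
  then show ?case using prods_arrows[OF Suc over_arrows[OF assms(1)]] by simp
qed

lemma walks_generated:
  assumes "K \<subseteq> arrows G" "A \<subseteq> gunits G"
  shows "walks G K A n \<subseteq> generated_subgroupoid G (over G K A) \<union> A"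
proof (induction n)
  case (Suc n)
  note sub = subgroupoid_generated[OF over_arrows[OF assms(1)]]
  have "gmul G g h \<in> generated_subgroupoid G (over G K A)"
    if "g \<in> walks G K A n" "h \<in> over G K A" "gsrc G g = grng G h" for g h
  proof -
    have h: "h \<in> generated_subgroupoid G (over G K A)" using that(2) generated_superset by blast
    then have "h \<in> arrows G" using subgroupoidD(2)[OF sub] by blast
    then show ?thesis
      using h that Suc subgroupoidD(4)[OF sub _ h] assms(2) by (metis UnE src_of_unit subset_iff unit_mul(1))
  qed
  then show ?case using Suc by (auto simp: prods_def)
qed auto

text \<open>
  Symmetry of \<open>K\<close> makes the reverse of a walk a walk.
\<close>

lemma generated_subset_walks:
  assumes K: "K \<subseteq> arrows G" "ginv G ` K \<subseteq> K" and A: "A \<subseteq> gunits G"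
  shows "generated_subgroupoid G (over G K A) \<subseteq> (\<Union>n. walks G K A n)"
proof (rule generated_least)
  let ?Q = "\<Union>n. walks G K A n"
  have arr: "?Q \<subseteq> arrows G" using walks_arrows[OF K(1) A] by blast
  have step: "gmul G g k \<in> ?Q" if "g \<in> ?Q" "k \<in> over G K A" "gsrc G g = grng G k" for g k
  proof -
    from that(1) obtain n where "g \<in> walks G K A n" by blast
    then have "gmul G g k \<in> walks G K A (Suc n)" using that by (auto intro: prodsI)
    then show ?thesis by blast
  qed
  have edge: "k \<in> ?Q" if "k \<in> over G K A" for k
  proof -
    have "k \<in> arrows G" "grng G k \<in> ?Q" using that K by (auto simp: over_def intro: exI[of _ 0])
    then show ?thesis using step[OF _ that, of "grng G k"] by simp
  qed
  have mult: "gmul G g h \<in> ?Q" if "g \<in> ?Q" "h \<in> ?Q" "gsrc G g = grng G h" for g h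
  proof -
    have "\<forall>h\<in>walks G K A n. gsrc G g = grng G h \<longrightarrow> gmul G g h \<in> ?Q" for n
    proof (induction n)
      case 0
      show ?case
      proof (intro ballI impI)
        fix h assume "h \<in> walks G K A 0" "gsrc G g = grng G h"
        then have "h \<in> gunits G" "gsrc G g = h" using A by auto
        moreover have "g \<in> arrows G" using that(1) arr by blast
        ultimately have "gmul G g h = g" by simp
        then show "gmul G g h \<in> ?Q" using that(1) by metis
      qed
    next
      case (Suc n)
      show ?case
      proof (intro ballI impI)
        fix h assume h: "h \<in> walks G K A (Suc n)" "gsrc G g = grng G h"
        show "gmul G g h \<in> ?Q"
        proof (cases "h \<in> walks G K A n")
          case False
          then obtain h' k where hk: "h' \<in> walks G K A n" "k \<in> over G K A" "gsrc G h' = grng G k" "h = gmul G h' k"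
            using h(1) by (auto simp: prods_def)
          have mem: "g \<in> arrows G" "h' \<in> arrows G" "k \<in> arrows G"
            using that(1) hk arr edge by blast+
          have "gsrc G g = grng G h'" using h(2) hk mem by simp
          with hk mem Suc have "gmul G g h' \<in> ?Q" by blast
          with step[OF this hk(2)] hk mem \<open>gsrc G g = grng G h'\<close> show ?thesis by (simp add: assoc)
        qed (use Suc h in blast)
      qed
    qed
    then show ?thesis using that by blast
  qed
  have inv: "ginv G h \<in> ?Q" if "h \<in> ?Q" for h
  proof -
    have "\<forall>h\<in>walks G K A n. ginv G h \<in> ?Q" for n
    proof (induction n)
      case 0
      show ?case
      proof
        fix h assume h: "h \<in> walks G K A 0"
        then have "ginv G h = h" using A by auto
        then show "ginv G h \<in> ?Q" using h by (metis UN_I UNIV_I)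
      qed
    next
      case (Suc n)
      show ?case
      proof
        fix h assume h: "h \<in> walks G K A (Suc n)"
        show "ginv G h \<in> ?Q"
        proof (cases "h \<in> walks G K A n")
          case False
          then obtain h' k where hk: "h' \<in> walks G K A n" "k \<in> over G K A" "gsrc G h' = grng G k" "h = gmul G h' k"
            using h(1) by (auto simp: prods_def)
          have mem: "h' \<in> arrows G" "k \<in> arrows G"
            using hk arr edge by blast+
          have "ginv G k \<in> over G K A" using hk(2) mem K(2) by (auto simp: over_def)
          then have "ginv G k \<in> ?Q" by (rule edge)
          with mult[OF this, of "ginv G h'"] Suc hk mem show ?thesis by simp
        qed (use Suc in blast)
      qed
    qed
    then show ?thesis using that by blast
  qed
  show "subgroupoid G ?Q" by (rule subgroupoidI) (use arr mult inv in blast)+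
  show "over G K A \<subseteq> ?Q" using edge by blast
qed

text \<open>
  Extending a walk on the right does not change its range. The walks of length at most \<open>N + 1\<close> with a
  given range are distinguished by the member of \<open>\<B>\<close> that contains them, so there are at most \<open>N\<close> of
  them. The increasing chain of these sets therefore stops growing before step \<open>N + 1\<close>, and a chain of
  this form that stops once is constant from then on. The bound \<open>N\<close> does not depend on the range.
\<close>

lemma walks_stabilise:
  assumes K: "K \<subseteq> arrows G" and A: "A \<subseteq> gunits G"
    and \<B>: "finite \<B>" "\<And>B. B \<in> \<B> \<Longrightarrow> inj_on (grng G) B"
    and cover: "walks G K A (Suc (card \<B>)) \<subseteq> \<Union>\<B>"
  shows "walks G K A m \<subseteq> walks G K A (card \<B>)"
proof
  fix g assume g: "g \<in> walks G K A m"
  define S where "S n = {h \<in> walks G K A n. grng G h = grng G g}" for n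
  let ?N = "card \<B>"
  have S_Suc: "S (Suc n) = S n \<union> prods G (S n) (over G K A)" for n
  proof -
    have "grng G (gmul G h k) = grng G h"
      if "h \<in> walks G K A n" "k \<in> over G K A" "gsrc G h = grng G k" for h k
      using that walks_arrows[OF K A, of n] over_arrows[OF K, of A] by (intro mul_simps(3)) blast+
    note rng = this
    show ?thesis
    proof (rule Set.set_eqI)
      fix x
      show "x \<in> S (Suc n) \<longleftrightarrow> x \<in> S n \<union> prods G (S n) (over G K A)"
      proof (cases "x \<in> walks G K A n")
        case True
        have "x \<in> S n" if "x \<in> prods G (S n) (over G K A)"
        proof -
          from that obtain h k where hk: "x = gmul G h k" "h \<in> S n" "k \<in> over G K A" "gsrc G h = grng G k"
            unfolding prods_def by blast
          then have "grng G x = grng G h" using rng unfolding S_def by blast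
          then show ?thesis using True hk(2) unfolding S_def by simp
        qed
        then show ?thesis using True by (auto simp: S_def)
      next
        case False
        have "x \<in> S (Suc n) \<longleftrightarrow> (\<exists>h k. x = gmul G h k \<and> h \<in> walks G K A n \<and> k \<in> over G K A \<and>
            gsrc G h = grng G k \<and> grng G x = grng G g)"
          unfolding S_def walks.simps prods_def using False by blast
        also have "\<dots> \<longleftrightarrow> x \<in> prods G (S n) (over G K A)"
          unfolding S_def prods_def using rng by force
        finally show ?thesis using False unfolding S_def by blast
      qed
    qed
  qed
  have S_mono: "S i \<subseteq> S j" if "i \<le> j" for i j
    using walks_increasing[OF that, of G K A] unfolding S_def by blast
  obtain \<beta> where \<beta>: "\<And>h. h \<in> S (Suc ?N) \<Longrightarrow> \<beta> h \<in> \<B> \<and> h \<in> \<beta> h"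
  proof -
    have "\<forall>h\<in>S (Suc ?N). \<exists>B. B \<in> \<B> \<and> h \<in> B" using cover unfolding S_def by blast
    from bchoice[OF this] show ?thesis using that by blast
  qed
  have inj: "inj_on \<beta> (S (Suc ?N))"
  proof (rule inj_onI)
    fix h h' assume h: "h \<in> S (Suc ?N)" "h' \<in> S (Suc ?N)" "\<beta> h = \<beta> h'"
    then have "inj_on (grng G) (\<beta> h)" "h \<in> \<beta> h" "h' \<in> \<beta> h" "grng G h = grng G h'"
      using \<beta>[OF h(1)] \<beta>[OF h(2)] \<B>(2) unfolding S_def by auto
    then show "h = h'" by (meson inj_onD)
  qed
  have "\<beta> ` S (Suc ?N) \<subseteq> \<B>" using \<beta> by blast
  then have fin: "finite (S (Suc ?N))" and card: "card (S (Suc ?N)) \<le> ?N"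
    using inj \<B>(1) by (meson inj_on_finite, meson card_inj_on_le)
  have "\<exists>n\<le>?N. S (Suc n) = S n"
  proof (rule ccontr)
    assume neq: "\<not> ?thesis"
    have "n \<le> Suc ?N \<Longrightarrow> n \<le> card (S n)" for n
    proof (induction n)
      case (Suc n)
      then have "S n \<subset> S (Suc n)" using neq S_mono[of n "Suc n"] by auto
      moreover have "finite (S (Suc n))" using fin S_mono[OF Suc.prems] finite_subset by blast
      ultimately have "card (S n) < card (S (Suc n))" by (simp add: psubset_card_mono)
      then show ?case using Suc by simp
    qed simp
    from this[of "Suc ?N"] card show False by simp
  qed
  then obtain n where n: "n \<le> ?N" "S (Suc n) = S n" by blast
  have const: "S (n + j) = S n" for j
    by (induction j) (use n(2) S_Suc in auto)
  have "S m \<subseteq> S n"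
  proof (cases "m \<le> n")
    case False
    then show ?thesis using const[of "m - n"] by simp
  qed (use S_mono in blast)
  then have "S m \<subseteq> S ?N" using S_mono[OF n(1)] by blast
  then show "g \<in> walks G K A ?N" using g unfolding S_def by blast
qed

text \<open>
  A tool for recognising that generated subgroupoids are small. The arrows in \<open>P\<close> are paths along which
  the points of \<open>grng G ` P\<close> are moved to a reference set. If conjugation by them carries the
  generators into \<open>E\<close>, it carries all products into \<open>E\<close>, because neighbouring factors can be conjugated
  by the same path at their common end. Generators away from \<open>grng G ` P\<close> never interact with the
  others and only have to lie in \<open>F\<close>.
\<close>

lemma generated_subset_of_conjugation:
  assumes F: "subgroupoid G F" and E: "subgroupoid G E" and P: "P \<subseteq> arrows G" and S: "S \<subseteq> arrows G"
    and inv: "\<And>g. g \<in> S \<Longrightarrow> grng G g \<in> grng G ` P \<longleftrightarrow> gsrc G g \<in> grng G ` P"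
    and out: "\<And>g. g \<in> S \<Longrightarrow> grng G g \<notin> grng G ` P \<Longrightarrow> g \<in> F"
    and conj: "\<And>g p q. \<lbrakk>g \<in> S; p \<in> P; q \<in> P; grng G p = grng G g; grng G q = gsrc G g\<rbrakk>
      \<Longrightarrow> gmul G (ginv G p) (gmul G g q) \<in> E"
  shows "generated_subgroupoid G S \<subseteq> F \<union> prods G P (prods G E (ginv G ` P))"
proof -
  define T where "T = {g \<in> arrows G. (grng G g \<in> grng G ` P \<longleftrightarrow> gsrc G g \<in> grng G ` P) \<and>
    (grng G g \<notin> grng G ` P \<longrightarrow> g \<in> F) \<and>
    (\<forall>p\<in>P. \<forall>q\<in>P. grng G p = grng G g \<longrightarrow> grng G q = gsrc G g \<longrightarrow>
       gmul G (ginv G p) (gmul G g q) \<in> E)}"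
  have "subgroupoid G T"
  proof (rule subgroupoidI)
    show "ginv G g \<in> T" if "g \<in> T" for g
    proof -
      have g: "g \<in> arrows G" using that unfolding T_def by blast
      have "gmul G (ginv G p) (gmul G (ginv G g) q) \<in> E"
        if pq: "p \<in> P" "q \<in> P" "grng G p = gsrc G g" "grng G q = grng G g" for p q
      proof -
        have "gmul G (ginv G q) (gmul G g p) \<in> E" using \<open>g \<in> T\<close> pq unfolding T_def by auto
        then have "ginv G (gmul G (ginv G q) (gmul G g p)) \<in> E" using subgroupoidD(3)[OF E] by blast
        moreover have "p \<in> arrows G" "q \<in> arrows G" using pq P by auto
        ultimately show ?thesis using g pq by (simp add: assoc)
      qed
      then show ?thesis using that subgroupoidD(3)[OF F] unfolding T_def by auto
    qed
    show "gmul G g h \<in> T" if "g \<in> T" "h \<in> T" "gsrc G g = grng G h" for g h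
    proof -
      have gh: "g \<in> arrows G" "h \<in> arrows G" using that unfolding T_def by blast+
      have "gmul G (ginv G p) (gmul G (gmul G g h) q) \<in> E"
        if pq: "p \<in> P" "q \<in> P" "grng G p = grng G g" "grng G q = gsrc G h" for p q
      proof -
        have "grng G g \<in> grng G ` P" using pq by (metis imageI)
        then have "gsrc G g \<in> grng G ` P" using \<open>g \<in> T\<close> unfolding T_def by blast
        then obtain r where r: "r \<in> P" "grng G r = gsrc G g" by auto
        have mem: "p \<in> arrows G" "q \<in> arrows G" "r \<in> arrows G" using pq r P by auto
        have "gmul G (ginv G p) (gmul G g r) \<in> E" "gmul G (ginv G r) (gmul G h q) \<in> E"
          using that \<open>g \<in> T\<close> \<open>h \<in> T\<close> r \<open>gsrc G g = grng G h\<close> unfolding T_def by auto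
        then have "gmul G (gmul G (ginv G p) (gmul G g r)) (gmul G (ginv G r) (gmul G h q)) \<in> E"
          by (rule subgroupoidD(4)[OF E]) (use mem gh pq r \<open>gsrc G g = grng G h\<close> in auto)
        then show ?thesis using mem gh pq r \<open>gsrc G g = grng G h\<close> by (simp add: assoc)
      qed
      then show ?thesis using that gh subgroupoidD(4)[OF F] unfolding T_def by auto
    qed
  qed (auto simp: T_def)
  moreover have "S \<subseteq> T" unfolding T_def using S inv out conj by blast
  ultimately have "generated_subgroupoid G S \<subseteq> T" by (rule generated_least)
  moreover have "T \<subseteq> F \<union> prods G P (prods G E (ginv G ` P))"
  proof
    fix g assume "g \<in> T"
    then have g: "g \<in> arrows G" unfolding T_def by blast
    show "g \<in> F \<union> prods G P (prods G E (ginv G ` P))"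
    proof (cases "grng G g \<in> grng G ` P")
      case True
      then have "gsrc G g \<in> grng G ` P" using \<open>g \<in> T\<close> unfolding T_def by blast
      with True obtain p q where pq: "p \<in> P" "q \<in> P" "grng G p = grng G g" "grng G q = gsrc G g"
        by auto
      have mem: "p \<in> arrows G" "q \<in> arrows G" using pq P by auto
      have "gmul G (ginv G p) (gmul G g q) \<in> E" using \<open>g \<in> T\<close> pq unfolding T_def by blast
      then have "gmul G p (gmul G (gmul G (ginv G p) (gmul G g q)) (ginv G q)) \<in> prods G P (prods G E (ginv G ` P))"
        using pq mem g by (intro prodsI) auto
      moreover have "gmul G p (gmul G (gmul G (ginv G p) (gmul G g q)) (ginv G q)) = g"
        using pq mem g by (simp add: assoc)
      ultimately show ?thesis by simp
    qed (use \<open>g \<in> T\<close> in \<open>auto simp: T_def\<close>)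
  qed
  ultimately show ?thesis by blast
qed

end

context Hausdorff_groupoid
begin

lemma compactin_walks:
  assumes "compactin (gtop G) K" "compactin (gtop G) A"
  shows "compactin (gtop G) (walks G K A n)"
  by (induction n) (auto simp: assms compactin_Un compactin_prods compactin_over)

lemma over_subset_open:
  assumes K: "compactin (gtop G) K" and A: "compactin (gtop G) A"
    and W: "openin (gtop G) W" "over G K A \<subseteq> W"
  obtains U where "openin (gtop G) U" "A \<subseteq> U" "over G K U \<subseteq> W"
proof -
  let ?X2 = "prod_topology (gtop G) (gtop G)"
  define D where "D = (\<lambda>g. (gsrc G g, grng G g)) ` (K - W)"
  have "compactin (gtop G) (K - W)"
  proof -
    have "compactin (gtop G) ((topspace (gtop G) - W) \<inter> K)"
      using K W(1) by (intro closed_Int_compactin) auto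
    moreover have "(topspace (gtop G) - W) \<inter> K = K - W" using compactin_subset_topspace[OF K] by blast
    ultimately show ?thesis by simp
  qed
  then have "compactin ?X2 D"
    unfolding D_def by (rule image_compactin) (simp add: continuous_map_paired continuous_src continuous_rng)
  then have "closedin ?X2 D"
    using Hausdorff_arrows by (simp add: compactin_imp_closedin Hausdorff_space_prod_topology)
  then have op: "openin ?X2 (topspace ?X2 - D)" by blast
  have sub: "A \<times> A \<subseteq> topspace ?X2 - D"
    using compactin_subset_topspace[OF A] W(2) unfolding D_def by (auto simp: over_def)
  obtain U V where UV: "openin (gtop G) U" "openin (gtop G) V" "A \<subseteq> U" "A \<subseteq> V"
    "U \<times> V \<subseteq> topspace ?X2 - D"
    by (rule Wallace_theorem_prod_topology[OF A A op sub])
  show thesis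
  proof (rule that[of "U \<inter> V"])
    show "over G K (U \<inter> V) \<subseteq> W"
    proof
      fix g assume "g \<in> over G K (U \<inter> V)"
      then have g: "g \<in> K" "(gsrc G g, grng G g) \<in> U \<times> V" by (auto simp: over_def)
      then have "(gsrc G g, grng G g) \<notin> D" using UV(5) by blast
      then show "g \<in> W" using g(1) unfolding D_def by blast
    qed
  qed (use UV in auto)
qed

text \<open>
  Wallace's theorem, applied to the complement of the composable pairs whose product avoids \<open>W\<close>. The
  latter set is closed because, in the Hausdorff case, the composable pairs form a closed set.
\<close>

lemma prods_subset_open:
  assumes C: "compactin (gtop G) C" and D: "compactin (gtop G) D"
    and W: "openin (gtop G) W" "prods G C D \<subseteq> W"
  obtains U V where "openin (gtop G) U" "openin (gtop G) V" "C \<subseteq> U" "D \<subseteq> V" "prods G U V \<subseteq> W"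
proof -
  let ?X2 = "prod_topology (gtop G) (gtop G)" and ?P = "composable_pairs G"
  define Z where "Z = {p \<in> topspace (subtopology ?X2 ?P). (\<lambda>(g, h). gmul G g h) p \<in> topspace (gtop G) - W}"
  have "closedin (subtopology ?X2 ?P) Z"
    unfolding Z_def using W(1) by (intro closedin_continuous_map_preimage[OF continuous_mul]) blast
  then have "closedin ?X2 Z" using closedin_composable closedin_trans_full by blast
  then have op: "openin ?X2 (topspace ?X2 - Z)" by blast
  have sub: "C \<times> D \<subseteq> topspace ?X2 - Z"
  proof
    fix p assume "p \<in> C \<times> D"
    then obtain g h where p: "p = (g, h)" "g \<in> C" "h \<in> D" by blast
    have "p \<notin> Z"
    proof
      assume "p \<in> Z"
      then have "gsrc G g = grng G h" "gmul G g h \<notin> W"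
        by (simp_all only: Z_def mem_Collect_eq prod.case topspace_subtopology Int_iff composable p(1) Diff_iff simp_thms)
      moreover from this have "gmul G g h \<in> prods G C D" using p by (intro prodsI)
      ultimately show False using W(2) by blast
    qed
    then show "p \<in> topspace ?X2 - Z"
      using p compactin_subset_topspace[OF C] compactin_subset_topspace[OF D] by auto
  qed
  obtain U V where UV: "openin (gtop G) U" "openin (gtop G) V" "C \<subseteq> U" "D \<subseteq> V"
    "U \<times> V \<subseteq> topspace ?X2 - Z"
    by (rule Wallace_theorem_prod_topology[OF C D op sub])
  show thesis
  proof (rule that[OF UV(1-4)])
    show "prods G U V \<subseteq> W"
    proof
      fix x assume "x \<in> prods G U V"
      then obtain g h where x: "x = gmul G g h" "g \<in> U" "h \<in> V" "gsrc G g = grng G h"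
        unfolding prods_def by blast
      have mem: "g \<in> arrows G" "h \<in> arrows G"
        using UV(1,2) x(2,3) openin_subset unfolding arrows_def by blast+
      have "(g, h) \<notin> Z" using UV(5) x by blast
      then show "x \<in> W" using x mem mul_simps(1)[OF mem x(4)] unfolding Z_def by (auto simp: composable arrows_def)
    qed
  qed
qed

text \<open>
  Upper semicontinuity of walks of a fixed length in the set of allowed units.
\<close>

lemma walks_subset_open:
  assumes K: "compactin (gtop G) K" and A: "compactin (gtop G) A"
  shows "openin (gtop G) W \<Longrightarrow> walks G K A n \<subseteq> W \<Longrightarrow>
    \<exists>U. openin (gtop G) U \<and> A \<subseteq> U \<and> walks G K U n \<subseteq> W"
proof (induction n arbitrary: W)
  case (Suc n)
  obtain W1 W2 where W12: "openin (gtop G) W1" "openin (gtop G) W2" "walks G K A n \<subseteq> W1"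
      "over G K A \<subseteq> W2" "prods G W1 W2 \<subseteq> W"
  proof -
    have "prods G (walks G K A n) (over G K A) \<subseteq> W" using Suc.prems(2) by simp
    from prods_subset_open[OF compactin_walks[OF K A] compactin_over[OF K A] Suc.prems(1) this]
    show ?thesis using that .
  qed
  obtain U1 where U1: "openin (gtop G) U1" "A \<subseteq> U1" "walks G K U1 n \<subseteq> W1 \<inter> W"
  proof -
    have "openin (gtop G) (W1 \<inter> W)" using W12(1) Suc.prems(1) by blast
    moreover have "walks G K A n \<subseteq> W1 \<inter> W" using W12(3) Suc.prems(2) by simp
    ultimately show ?thesis using Suc.IH[of "W1 \<inter> W"] that by blast
  qed
  obtain U2 where U2: "openin (gtop G) U2" "A \<subseteq> U2" "over G K U2 \<subseteq> W2"
    by (rule over_subset_open[OF K A W12(2,4)])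
  have "walks G K (U1 \<inter> U2) n \<subseteq> W1 \<inter> W" "over G K (U1 \<inter> U2) \<subseteq> W2"
    using walks_mono[of "U1 \<inter> U2" U1 G K n] over_mono[of K K "U1 \<inter> U2" U2 G] U1 U2 by blast+
  then have "walks G K (U1 \<inter> U2) (Suc n) \<subseteq> W"
    using prods_mono[of "walks G K (U1 \<inter> U2) n" W1 "over G K (U1 \<inter> U2)" W2 G] W12(5) by auto
  then show ?case using U1 U2 by (intro exI[of _ "U1 \<inter> U2"]) auto
next
  case 0
  then show ?case by (intro exI[of _ W]) simp
qed

end

context etale_groupoid
begin

lemma compactin_bisection_cover:
  assumes "compactin (gtop G) C"
  obtains \<B> where "finite \<B>" "C \<subseteq> \<Union>\<B>" "\<And>B. B \<in> \<B> \<Longrightarrow> openin (gtop G) B \<and> inj_on (grng G) B"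
proof -
  have "\<exists>B. openin (gtop G) B \<and> inj_on (grng G) B \<and> g \<in> B" if "g \<in> C" for g
  proof -
    have "g \<in> topspace (gtop G)" using assms that compactin_subset_topspace by blast
    then obtain U where U: "openin (gtop G) U" "g \<in> U"
      "homeomorphic_map (subtopology (gtop G) U) (subtopology (unit_space G) (grng G ` U)) (grng G)"
      using rng_local_homeo unfolding local_homeomorphism_def by blast
    have "inj_on (grng G) U"
      using homeomorphic_imp_injective_map[OF U(3)] openin_subset[OF U(1)] by (simp add: inf_absorb2)
    with U show ?thesis by blast
  qed
  then have "C \<subseteq> \<Union>{B. openin (gtop G) B \<and> inj_on (grng G) B}" by blast
  then obtain \<B> where "finite \<B>" "\<B> \<subseteq> {B. openin (gtop G) B \<and> inj_on (grng G) B}" "C \<subseteq> \<Union>\<B>"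
    using assms unfolding compactin_def by (metis (mono_tags, lifting) mem_Collect_eq)
  then show thesis by (intro that) auto
qed

lemma compact_neighbourhood:
  assumes "compactin (gtop G) C"
  obtains O' L where "openin (gtop G) O'" "compactin (gtop G) L" "C \<subseteq> O'" "O' \<subseteq> L"
proof -
  have "\<exists>U L. openin (gtop G) U \<and> compactin (gtop G) L \<and> closedin (gtop G) L \<and> C \<subseteq> U \<and> U \<subseteq> L"
    using locally_compact Hausdorff assms locally_compact_space_compact_closed_compact[of "gtop G"] by blast
  then show thesis using that by blast
qed

text \<open>
  The walks inside \<open>A\<close> of length at most \<open>N + 1\<close> lie in the union of \<open>N\<close> open sets on which the range map
  is injective. By semicontinuity the same holds for a neighbourhood \<open>U\<close> of \<open>A\<close>, so that walks in \<open>U\<close>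
  stabilise at length \<open>N\<close>; these lie in a compact set if \<open>U\<close> does.
\<close>

lemma tame_open_enlargement:
  assumes K: "compactin (gtop G) K" and A: "compactin (gtop G) A" "A \<subseteq> gunits G"
    and tame: "tame G K A"
  obtains U where "openin (unit_space G) U" "A \<subseteq> U" "tame G K U"
proof -
  define L where "L = K \<union> ginv G ` K"
  have L: "compactin (gtop G) L" unfolding L_def by (intro compactin_Un K compactin_inverses)
  have LG: "L \<subseteq> arrows G" using L by (rule compactin_arrows)
  have Linv: "ginv G ` L \<subseteq> L" unfolding L_def using compactin_arrows[OF K] by auto
  obtain C where C: "compactin (gtop G) C" "generated_subgroupoid G (over G K A) \<subseteq> C"
    using tame unfolding tame_def by blast
  have "generated_subgroupoid G (over G L A) \<subseteq> generated_subgroupoid G (over G K A)"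
  proof (rule generated_least)
    have KG: "over G K A \<subseteq> arrows G" using compactin_arrows[OF K] over_arrows by blast
    show sub: "subgroupoid G (generated_subgroupoid G (over G K A))"
      by (rule subgroupoid_generated[OF KG])
    show "over G L A \<subseteq> generated_subgroupoid G (over G K A)"
    proof
      fix g assume g: "g \<in> over G L A"
      show "g \<in> generated_subgroupoid G (over G K A)"
      proof (cases "g \<in> K")
        case True
        then show ?thesis using g generated_superset by (force simp: over_def)
      next
        case False
        then obtain k where k: "k \<in> K" "g = ginv G k" using g by (auto simp: over_def L_def)
        then have "k \<in> over G K A" using g compactin_arrows[OF K] by (auto simp: over_def)
        then show ?thesis using subgroupoidD(3)[OF sub] generated_superset k by blast
      qed
    qed
  qed
  then have walksA: "walks G L A n \<subseteq> C \<union> A" for n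
    using walks_generated[OF LG A(2), of n] C(2) by blast
  obtain \<B> where \<B>: "finite \<B>" "C \<union> A \<subseteq> \<Union>\<B>" "\<And>B. B \<in> \<B> \<Longrightarrow> openin (gtop G) B \<and> inj_on (grng G) B"
    by (rule compactin_bisection_cover[OF compactin_Un[OF C(1) A(1)]]) (rule that)
  obtain U1 where U1: "openin (gtop G) U1" "A \<subseteq> U1" "walks G L U1 (Suc (card \<B>)) \<subseteq> \<Union>\<B>"
  proof -
    have "openin (gtop G) (\<Union>\<B>)" using \<B>(3) by blast
    moreover have "walks G L A (Suc (card \<B>)) \<subseteq> \<Union>\<B>" using walksA \<B>(2) by (rule order_trans)
    ultimately show ?thesis using walks_subset_open[OF L A(1)] that by blast
  qed
  obtain O' V where V: "openin (gtop G) O'" "compactin (gtop G) V" "A \<subseteq> O'" "O' \<subseteq> V"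
    by (rule compact_neighbourhood[OF A(1)])
  define U where "U = U1 \<inter> O' \<inter> gunits G"
  have Uunits: "U \<subseteq> gunits G" unfolding U_def by blast
  have "walks G L U (Suc (card \<B>)) \<subseteq> \<Union>\<B>"
    using U1(3) walks_mono[of U U1 G L "Suc (card \<B>)"] unfolding U_def by blast
  then have "(\<Union>n. walks G L U n) \<subseteq> walks G L U (card \<B>)"
    using walks_stabilise[OF LG Uunits \<B>(1)] \<B>(3) by blast
  also have "\<dots> \<subseteq> walks G L V (card \<B>)" by (rule walks_mono) (use V(4) U_def in blast)
  finally have "generated_subgroupoid G (over G L U) \<subseteq> walks G L V (card \<B>)"
    using generated_subset_walks[OF LG Linv Uunits] by blast
  then have "tame G L U" unfolding tame_def using compactin_walks[OF L V(2)] by blast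
  then have "tame G K U" by (rule tame_mono) (use L_def in blast)+
  moreover have "openin (unit_space G) U"
    unfolding U_def unit_space_def by (intro openin_subtopology_Int openin_Int U1 V)
  moreover have "A \<subseteq> U" using U1 V A unfolding U_def by blast
  ultimately show thesis by (rule that[rotated 2])
qed

end

section \<open>Dimension of compact sets of units\<close>

text \<open>
  Relative to a set \<open>A\<close> of units, so that the same notion serves for \<open>G\<close>, for its restrictions and
  for the pieces into which a compact set is cut.
\<close>

definition dad_over :: "'a groupoid_data \<Rightarrow> 'a set \<Rightarrow> nat \<Rightarrow> bool" where
  "dad_over G A d \<longleftrightarrow> (\<forall>K. compactin (gtop G) K \<longrightarrow>
     (\<exists>B. (\<forall>i\<le>d. compactin (gtop G) (B i) \<and> tame G K (B i)) \<and> A = (\<Union>i\<le>d. B i)))"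

context topological_groupoid
begin

lemma openin_unit_space_trace:
  assumes "openin (unit_space G) V" "A \<subseteq> gunits G"
  shows "openin (subtopology (gtop G) A) (A \<inter> V)"
proof -
  obtain W where W: "openin (gtop G) W" "V = W \<inter> gunits G"
    using assms(1) unfolding unit_space_def openin_subtopology by blast
  then have "A \<inter> V = A \<inter> W" using assms(2) by blast
  then show ?thesis using openin_subtopology_Int2[OF W(1)] by simp
qed

lemma openin_unit_space_subset: "openin (unit_space G) U \<Longrightarrow> U \<subseteq> gunits G"
  unfolding unit_space_def openin_subtopology by blast

lemma arrows_restriction: "arrows (restriction G U) = over G (arrows G) U"
  by (auto simp: arrows_def restriction_def over_def)

lemma gtop_restriction: "gtop (restriction G U) = subtopology (gtop G) (over G (arrows G) U)"
proof -
  have "over G (arrows G) U = topspace (gtop G) \<inter> {g. gsrc G g \<in> U \<and> grng G g \<in> U}"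
    by (auto simp: over_def arrows_def)
  then show ?thesis by (simp only: restriction_def groupoid_data.select_convs subtopology_restrict)
qed

lemma restriction_units: "restriction G (gunits G) = G"
proof -
  have "over G (arrows G) (gunits G) = topspace (gtop G)"
    using src_unit rng_unit by (auto simp: over_def arrows_def[symmetric])
  then have "gtop (restriction G (gunits G)) = gtop G"
    unfolding gtop_restriction by simp
  then show ?thesis by (simp add: restriction_def)
qed

lemma subgroupoid_restriction:
  "subgroupoid (restriction G U) S \<longleftrightarrow> subgroupoid G S \<and> S \<subseteq> over G (arrows G) U"
proof -
  have ops: "gmul (restriction G U) = gmul G" "ginv (restriction G U) = ginv G"
    "gsrc (restriction G U) = gsrc G" "grng (restriction G U) = grng G"
    by (simp_all add: restriction_def)
  have "over G (arrows G) U \<subseteq> arrows G" unfolding over_def by blast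
  then show ?thesis
    unfolding subgroupoid_def arrows_restriction composable_pairs_def ops mem_Collect_eq prod.case by blast
qed

lemma generated_restriction:
  assumes "S \<subseteq> over G (arrows G) U"
  shows "generated_subgroupoid (restriction G U) S = generated_subgroupoid G S"
proof
  have S: "S \<subseteq> arrows G" using assms unfolding over_def by blast
  have "generated_subgroupoid G S \<subseteq> over G (arrows G) U"
    using generated_least[OF subgroupoid_over assms] .
  then have "subgroupoid (restriction G U) (generated_subgroupoid G S)"
    using subgroupoid_generated[OF S] subgroupoid_restriction by blast
  then show "generated_subgroupoid (restriction G U) S \<subseteq> generated_subgroupoid G S"
    unfolding generated_subgroupoid_def[of "restriction G U"]
    by (intro hull_minimal generated_superset)
  show "generated_subgroupoid G S \<subseteq> generated_subgroupoid (restriction G U) S"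
    unfolding generated_subgroupoid_def by (rule hull_antimono) (simp add: subgroupoid_restriction)
qed

lemma unit_in_over: "U \<subseteq> gunits G \<Longrightarrow> U \<subseteq> over G (arrows G) U"
proof
  fix u assume "U \<subseteq> gunits G" "u \<in> U"
  then have "u \<in> gunits G" by blast
  then show "u \<in> over G (arrows G) U" using \<open>u \<in> U\<close> unit_arrow by (simp add: over_def)
qed

lemma openin_unit_space_restriction:
  assumes "openin (unit_space G) U"
  shows "openin (unit_space (restriction G U)) V \<longleftrightarrow> openin (unit_space G) V \<and> V \<subseteq> U"
proof -
  have U: "U \<subseteq> gunits G" using openin_unit_space_subset[OF assms] .
  have "unit_space (restriction G U) = subtopology (gtop G) (over G (arrows G) U \<inter> (gunits G \<inter> U))"
    unfolding unit_space_def gtop_restriction subtopology_subtopology by (simp add: restriction_def)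
  also have "over G (arrows G) U \<inter> (gunits G \<inter> U) = gunits G \<inter> U" using unit_in_over[OF U] by blast
  also have "subtopology (gtop G) (gunits G \<inter> U) = subtopology (unit_space G) U"
    unfolding unit_space_def subtopology_subtopology ..
  finally show ?thesis using openin_open_subtopology[OF assms] by simp
qed

end

context etale_groupoid
begin

text \<open>
  From left to right, an open relatively compact set of arrows around the part of \<open>K\<close> over \<open>A\<close> yields
  an open cover of \<open>A\<close>, which is shrunk to a compact one. From right to left, the compact cover of the
  sources and ranges of the closure is enlarged to an open one. Being relatively compact in the restriction
  and in \<open>G\<close> is the same here since all generated arrows start and end in a compact subset of \<open>U\<close>.
\<close>

lemma dad_at_most_restriction_iff:
  assumes U: "openin (unit_space G) U"
  shows "dad_at_most (restriction G U) d \<longleftrightarrow>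
    (\<forall>A. compactin (gtop G) A \<and> A \<subseteq> U \<longrightarrow> dad_over G A d)"
proof -
  let ?R = "restriction G U" and ?Y = "over G (arrows G) U"
  have UG: "U \<subseteq> gunits G" using openin_unit_space_subset[OF U] .
  have openR: "openin (gtop ?R) K \<longleftrightarrow> openin (gtop G) K \<and> K \<subseteq> ?Y" for K
    unfolding gtop_restriction using openin_open_subtopology[OF openin_over[OF U]] .
  have compactR: "compactin (gtop ?R) K \<longleftrightarrow> compactin (gtop G) K \<and> K \<subseteq> ?Y" for K
    unfolding gtop_restriction compactin_subtopology ..
  have HausR: "Hausdorff_space (gtop ?R)"
    unfolding gtop_restriction using Hausdorff Hausdorff_space_subtopology by blast
  have rcR: "relatively_compact (gtop ?R) K \<longleftrightarrow> (\<exists>C. compactin (gtop G) C \<and> C \<subseteq> ?Y \<and> K \<subseteq> C)" for K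
    unfolding relatively_compact_iff_subset_compact[OF HausR] compactR by blast
  have srcR: "gsrc ?R = gsrc G" "grng ?R = grng G" by (simp_all add: restriction_def)
  have overR: "K \<inter> arrows (restriction ?R V) = over G K V" if "K \<subseteq> ?Y" for K V
  proof -
    have "arrows (restriction ?R V) = over G ?Y V"
      by (auto simp: arrows_def restriction_def over_def)
    then show ?thesis using that unfolding over_def by blast
  qed
  have genR: "generated_subgroupoid ?R (K \<inter> arrows (restriction ?R V)) = generated_subgroupoid G (over G K V)"
    if "K \<subseteq> ?Y" for K V
    unfolding overR[OF that] by (rule generated_restriction) (use that in \<open>auto simp: over_def\<close>)
  show ?thesis
  proof (intro iffI allI impI)
    fix A assume dad: "dad_at_most ?R d" and A: "compactin (gtop G) A \<and> A \<subseteq> U"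
    then have AG: "A \<subseteq> gunits G" using UG by blast
    show "dad_over G A d"
      unfolding dad_over_def
    proof (intro allI impI)
      fix K assume K: "compactin (gtop G) K"
      have "compactin (gtop ?R) (over G K A \<union> A)"
      proof -
        have "compactin (gtop G) (over G K A \<union> A)"
          using A K by (intro compactin_Un compactin_over) auto
        moreover have "over G K A \<subseteq> ?Y" using A compactin_arrows[OF K] by (auto simp: over_def)
        moreover have "A \<subseteq> ?Y" using A unit_in_over[OF UG] by blast
        ultimately show ?thesis unfolding compactR by blast
      qed
      moreover have "locally_compact_space (gtop ?R)"
        unfolding gtop_restriction using Hausdorff locally_compact openin_over[OF U] locally_compact_space_open_subset by blast
      ultimately obtain O' L where O': "openin (gtop ?R) O'" "compactin (gtop ?R) L"
        "over G K A \<union> A \<subseteq> O'" "O' \<subseteq> L"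
        using locally_compact_space_compact_closed_compact[of "gtop ?R"] HausR by blast
      have OY: "O' \<subseteq> ?Y" using O'(1) openR by blast
      have rc: "relatively_compact (gtop ?R) O'" unfolding rcR using O'(2,4) compactR by blast
      obtain V where V: "\<forall>i\<le>d. openin (unit_space ?R) (V i)"
        "gsrc G ` O' \<union> grng G ` O' \<subseteq> (\<Union>i\<le>d. V i)"
        "\<forall>i\<le>d. relatively_compact (gtop ?R) (generated_subgroupoid ?R (O' \<inter> arrows (restriction ?R (V i))))"
        using dad[unfolded dad_at_most_def srcR, rule_format, OF conjI[OF O'(1) rc]] by (elim exE conjE) (rule that)
      have Vcov: "\<exists>i\<in>{..d}. x \<in> V i" if "x \<in> A" for x
      proof -
        have "x \<in> O'" "gsrc G x = x" using that O'(3) AG by auto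
        then have "x \<in> (\<Union>i\<le>d. V i)" using V(2) by (metis UnI1 imageI subsetD)
        then show ?thesis by blast
      qed
      have Vop: "openin (subtopology (gtop G) A) (A \<inter> V i)" if "i \<in> {..d}" for i
        using V(1) that AG openin_unit_space_restriction[OF U] by (intro openin_unit_space_trace) auto
      obtain B where B: "\<And>i. compactin (gtop G) (B i) \<and> B i \<subseteq> A \<inter> V i"
        "\<And>x. x \<in> A \<Longrightarrow> \<exists>y\<in>A. \<forall>i\<in>{..d}. y \<in> V i \<longrightarrow> x \<in> B i"
        by (rule compactin_open_family_shrinking[OF Hausdorff conjunct1[OF A] finite_atMost Vop Vcov]) blast+
      show "\<exists>B. (\<forall>i\<le>d. compactin (gtop G) (B i) \<and> tame G K (B i)) \<and> A = (\<Union>i\<le>d. B i)"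
      proof (intro exI conjI allI impI)
        show "compactin (gtop G) (B i)" for i using B(1) by blast
        show "tame G K (B i)" if "i \<le> d" for i
        proof -
          obtain C where C: "compactin (gtop G) C" "generated_subgroupoid G (over G O' (V i)) \<subseteq> C"
          proof -
            have "relatively_compact (gtop ?R) (generated_subgroupoid G (over G O' (V i)))"
              using V(3) \<open>i \<le> d\<close> unfolding genR[OF OY] by blast
            from this[unfolded rcR] show ?thesis using that by blast
          qed
          have sub: "over G K (B i) \<subseteq> over G O' (V i)"
            using B(1)[of i] O'(3) unfolding over_def by blast
          have "generated_subgroupoid G (over G K (B i)) \<subseteq> C"
            using generated_mono[OF sub] C(2) by blast
          then show ?thesis using C(1) unfolding tame_def by blast
        qed
        show "A = (\<Union>i\<le>d. B i)"
        proof
          show "A \<subseteq> (\<Union>i\<le>d. B i)"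
          proof
            fix x assume "x \<in> A"
            then obtain y where y: "y \<in> A" "\<forall>i\<in>{..d}. y \<in> V i \<longrightarrow> x \<in> B i" using B(2) by blast
            then show "x \<in> (\<Union>i\<le>d. B i)" using Vcov[OF y(1)] by blast
          qed
          show "(\<Union>i\<le>d. B i) \<subseteq> A" using B(1) by blast
        qed
      qed
    qed
  next
    assume dad: "\<forall>A. compactin (gtop G) A \<and> A \<subseteq> U \<longrightarrow> dad_over G A d"
    show "dad_at_most ?R d"
      unfolding dad_at_most_def srcR
    proof (intro allI impI)
      fix K assume K: "openin (gtop ?R) K \<and> relatively_compact (gtop ?R) K"
      have KY: "K \<subseteq> ?Y" by (rule conjunct2[OF conjunct1[OF K, unfolded openR]])
      have "\<exists>C. compactin (gtop G) C \<and> C \<subseteq> ?Y \<and> K \<subseteq> C" by (rule conjunct2[OF K, unfolded rcR])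
      then obtain C where C: "compactin (gtop G) C" "C \<subseteq> ?Y" "K \<subseteq> C" by blast
      define A where "A = gsrc G ` C \<union> grng G ` C"
      have A: "compactin (gtop G) A" "A \<subseteq> U"
        unfolding A_def using C(1,2)
        by (auto intro!: compactin_Un compactin_sources compactin_ranges simp: over_def)
      then have "dad_over G A d" using dad by blast
      then obtain B where B: "\<forall>i\<le>d. compactin (gtop G) (B i) \<and> tame G C (B i)" "A = (\<Union>i\<le>d. B i)"
        unfolding dad_over_def using C(1) by blast
      have "\<exists>V. openin (unit_space G) V \<and> B i \<subseteq> V \<and> tame G C V" if "i \<le> d" for i
      proof -
        have "B i \<subseteq> gunits G" using B(2) A(2) UG that by blast
        moreover have "compactin (gtop G) (B i)" "tame G C (B i)" using B(1) that by blast+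
        ultimately obtain V where "openin (unit_space G) V" "B i \<subseteq> V" "tame G C V"
          using tame_open_enlargement[OF C(1)] by blast
        then show ?thesis by blast
      qed
      then obtain V where V: "\<And>i. i \<le> d \<Longrightarrow> openin (unit_space G) (V i) \<and> B i \<subseteq> V i \<and> tame G C (V i)"
        by metis
      show "\<exists>V. (\<forall>i\<le>d. openin (unit_space ?R) (V i)) \<and>
          gsrc G ` K \<union> grng G ` K \<subseteq> (\<Union>i\<le>d. V i) \<and>
          (\<forall>i\<le>d. relatively_compact (gtop ?R) (generated_subgroupoid ?R (K \<inter> arrows (restriction ?R (V i)))))"
      proof (intro exI conjI allI impI)
        show "openin (unit_space ?R) (V i \<inter> U)" if "i \<le> d" for i
          unfolding openin_unit_space_restriction[OF U] using V[OF that] U by blast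
        have "gsrc G ` K \<union> grng G ` K \<subseteq> A" unfolding A_def using C(3) by blast
        also have "A \<subseteq> (\<Union>i\<le>d. V i \<inter> U)" 
        proof
          fix x assume "x \<in> A"
          then obtain i where "i \<le> d" "x \<in> B i" using B(2) by blast
          then show "x \<in> (\<Union>i\<le>d. V i \<inter> U)" using V[of i] \<open>x \<in> A\<close> A(2) by blast
        qed
        finally show "gsrc G ` K \<union> grng G ` K \<subseteq> (\<Union>i\<le>d. V i \<inter> U)" .
        show "relatively_compact (gtop ?R) (generated_subgroupoid ?R (K \<inter> arrows (restriction ?R (V i \<inter> U))))"
          if "i \<le> d" for i
        proof -
          obtain D where D: "compactin (gtop G) D" "generated_subgroupoid G (over G C (V i)) \<subseteq> D"
            using V[OF \<open>i \<le> d\<close>] unfolding tame_def by blast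
          have sub: "over G K (V i \<inter> U) \<subseteq> over G C (V i)" using C(3) unfolding over_def by blast
          have 1: "generated_subgroupoid G (over G K (V i \<inter> U)) \<subseteq> D"
            using generated_mono[OF sub] D(2) by blast
          have "over G K (V i \<inter> U) \<subseteq> over G (arrows G) A"
            using C(3) compactin_arrows[OF C(1)] unfolding over_def A_def by blast
          then have "generated_subgroupoid G (over G K (V i \<inter> U)) \<subseteq> over G (arrows G) A"
            by (rule generated_least[OF subgroupoid_over])
          with 1 have "generated_subgroupoid G (over G K (V i \<inter> U)) \<subseteq> over G D A"
            unfolding over_def by blast
          moreover have "over G D A \<subseteq> ?Y" using compactin_arrows[OF D(1)] A(2) unfolding over_def by blast
          ultimately show ?thesis
            unfolding rcR genR[OF KY] using compactin_over[OF D(1) A(1)] by blast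
        qed
      qed
    qed
  qed
qed

end

context Hausdorff_groupoid
begin

text \<open>
  A walk with steps in \<open>L\<close> through \<open>A \<union> B\<close> either stays in \<open>A\<close>, or splits at its visits to \<open>B\<close> into
  single steps and excursions through \<open>A\<close>. An excursion is a step into \<open>A\<close>, a walk inside \<open>A\<close>, which
  belongs to \<open>C\<close>, and a step back, so it belongs to \<open>prods G L (prods G C L)\<close>. The paths \<open>P\<close> used for the
  conjugation lead from a first or last visit to \<open>B\<close> to the end of the walk.
\<close>

lemma tame_Un:
  assumes L: "compactin (gtop G) L" "ginv G ` L \<subseteq> L" "A \<union> B \<subseteq> L"
    and units: "A \<subseteq> gunits G" "B \<subseteq> gunits G" and Bc: "compactin (gtop G) B"
    and C: "compactin (gtop G) C" "generated_subgroupoid G (over G L A) \<subseteq> C"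
    and tame: "tame G (L \<union> prods G L (prods G C L)) B"
  shows "tame G L (A \<union> B)"
proof -
  let ?K = "L \<union> prods G L (prods G C L)"
  define F where "F = generated_subgroupoid G (over G L A)"
  define E where "E = generated_subgroupoid G (over G ?K B)"
  define P where "P = {p \<in> B \<union> prods G F L. gsrc G p \<in> B}"
  have LG: "L \<subseteq> arrows G" and CG: "C \<subseteq> arrows G" using L(1) C(1) compactin_arrows by auto
  have KG: "?K \<subseteq> arrows G" using LG CG by (simp add: prods_arrows)
  have F: "subgroupoid G F" unfolding F_def using over_arrows[OF LG] by (rule subgroupoid_generated)
  have E: "subgroupoid G E" unfolding E_def using over_arrows[OF KG] by (rule subgroupoid_generated)
  have FC: "F \<subseteq> C" unfolding F_def by (rule C(2))
  have FG: "f \<in> arrows G" "gsrc G f \<in> A" "grng G f \<in> A" if "f \<in> F" for f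
    using generated_over_units[OF LG] that unfolding F_def by blast+
  have LF: "g \<in> F" if "g \<in> L" "gsrc G g \<in> A" "grng G g \<in> A" for g
    using generated_superset[of "over G L A"] that unfolding F_def over_def by blast
  have KE: "g \<in> E" if "g \<in> ?K" "gsrc G g \<in> B" "grng G g \<in> B" for g
    using generated_superset[of "over G ?K B"] that unfolding E_def over_def by blast
  have BP: "b \<in> P" if "b \<in> B" for b using that units(2) unfolding P_def by auto
  have FLP: "gmul G f k \<in> P" if "f \<in> F" "k \<in> L" "gsrc G f = grng G k" "gsrc G k \<in> B" for f k
  proof -
    have "gsrc G (gmul G f k) = gsrc G k" using that FG(1) LG by (intro mul_simps) auto
    then show ?thesis using that unfolding P_def by (auto intro: prodsI)
  qed
  have Pcases: "p \<in> B \<or> (\<exists>f k. p = gmul G f k \<and> f \<in> F \<and> k \<in> L \<and> f \<in> arrows G \<and> k \<in> arrows G \<and>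
      gsrc G f = grng G k \<and> gsrc G k \<in> B \<and> grng G f \<in> A)" if "p \<in> P" for p
  proof (cases "p \<in> B")
    case False
    then obtain f k where fk: "p = gmul G f k" "f \<in> F" "k \<in> L" "gsrc G f = grng G k" "gsrc G p \<in> B"
      using \<open>p \<in> P\<close> unfolding P_def prods_def by blast
    then have "f \<in> arrows G" "k \<in> arrows G" "grng G f \<in> A" using FG LG by auto
    then show ?thesis using fk by auto
  qed blast
  have PG: "P \<subseteq> arrows G"
    using FG(1) LG units(2) unit_arrow prods_arrows[of F L] unfolding P_def by blast
  have reach: "grng G g \<in> grng G ` P" if g: "g \<in> over G L (A \<union> B)" "gsrc G g \<in> grng G ` P" for g
  proof (cases "grng G g \<in> B")
    case True
    then have "grng G (grng G g) = grng G g" using units by auto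
    then show ?thesis using BP[OF True] by (metis imageI)
  next
    case False
    have gL: "g \<in> L" "g \<in> arrows G" and gA: "grng G g \<in> A"
      using g(1) LG False by (auto simp: over_def)
    obtain q where q: "q \<in> P" "gsrc G g = grng G q" using g(2) by blast
    from Pcases[OF q(1)] show ?thesis
    proof (elim disjE exE conjE)
      assume "q \<in> B"
      then have "gsrc G g \<in> B" using q(2) units by auto
      moreover have "grng G g \<in> F" using gA units L(3) by (intro LF) auto
      ultimately have "gmul G (grng G g) g \<in> P" using gL by (intro FLP) auto
      then have "g \<in> P" using gL by simp
      then show ?thesis by blast
    next
      fix f k assume fk: "q = gmul G f k" "f \<in> F" "k \<in> L" "f \<in> arrows G" "k \<in> arrows G"
        "gsrc G f = grng G k" "gsrc G k \<in> B" "grng G f \<in> A"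
      then have s: "gsrc G g = grng G f" using q(2) by simp
      then have "g \<in> F" using gL gA fk by (intro LF) auto
      then have "gmul G g f \<in> F" using fk s subgroupoidD(4)[OF F] by blast
      then have "gmul G (gmul G g f) k \<in> P" using fk s gL by (intro FLP) auto
      moreover have "grng G (gmul G (gmul G g f) k) = grng G g" using fk s gL by simp
      ultimately show ?thesis by (metis imageI)
    qed
  qed
  have LCL: "gmul G k (gmul G f k') \<in> E"
    if "k \<in> L" "f \<in> F" "k' \<in> L" "gsrc G k = grng G f" "gsrc G f = grng G k'" "grng G k \<in> B" "gsrc G k' \<in> B"
    for k f k'
  proof (rule KE)
    have mem: "k \<in> arrows G" "f \<in> arrows G" "k' \<in> arrows G" using that LG FG by auto
    have "gmul G f k' \<in> prods G C L" using that subsetD[OF FC] by (intro prodsI)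
    then have "gmul G k (gmul G f k') \<in> prods G L (prods G C L)"
      by (rule prodsI[OF that(1)]) (use that mem in simp)
    then show "gmul G k (gmul G f k') \<in> ?K" by blast
    show "gsrc G (gmul G k (gmul G f k')) \<in> B" "grng G (gmul G k (gmul G f k')) \<in> B"
      using that mem by auto
  qed
  have "generated_subgroupoid G (over G L (A \<union> B)) \<subseteq> F \<union> prods G P (prods G E (ginv G ` P))"
  proof (rule generated_subset_of_conjugation[OF F E PG over_arrows[OF LG]])
    fix g assume g: "g \<in> over G L (A \<union> B)"
    then have gG: "g \<in> arrows G" "g \<in> L" using LG by (auto simp: over_def)
    have "ginv G g \<in> over G L (A \<union> B)" using g gG L(2) by (auto simp: over_def)
    from reach[OF this] reach[OF g] gG
    show "grng G g \<in> grng G ` P \<longleftrightarrow> gsrc G g \<in> grng G ` P" by auto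
    show "g \<in> F" if "grng G g \<notin> grng G ` P"
    proof -
      have "gsrc G g \<notin> grng G ` P" using that reach[OF g] by blast
      have "b \<in> grng G ` P" if "b \<in> B" for b
      proof -
        have "grng G b = b" using that units by auto
        then show ?thesis using BP[OF that] by (metis imageI)
      qed
      then have "gsrc G g \<notin> B" "grng G g \<notin> B" using \<open>gsrc G g \<notin> grng G ` P\<close> that by blast+
      then show ?thesis using g by (intro LF) (auto simp: over_def)
    qed
  next
    fix g p q assume g: "g \<in> over G L (A \<union> B)" and pq: "p \<in> P" "q \<in> P" "grng G p = grng G g" "grng G q = gsrc G g"
    have gG: "g \<in> arrows G" "g \<in> L" using g LG by (auto simp: over_def)
    have invL: "ginv G k \<in> L" if "k \<in> L" for k using that L(2) by blast
    show "gmul G (ginv G p) (gmul G g q) \<in> E"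
      using Pcases[OF pq(1)] Pcases[OF pq(2)]
    proof (elim disjE exE conjE)
      assume "p \<in> B" "q \<in> B"
      then have B: "p \<in> gunits G" "q \<in> gunits G" "p = grng G g" "q = gsrc G g"
        using units pq by auto
      then have "gmul G (ginv G p) (gmul G g q) = g" using gG by simp
      moreover have "g \<in> E" using \<open>p \<in> B\<close> \<open>q \<in> B\<close> B gG by (intro KE) auto
      ultimately show ?thesis by simp
    next
      fix f k assume p: "p \<in> B" and fk: "q = gmul G f k" "f \<in> F" "k \<in> L" "f \<in> arrows G" "k \<in> arrows G"
        "gsrc G f = grng G k" "gsrc G k \<in> B" "grng G f \<in> A"
      have s: "gsrc G g = grng G f" using fk pq by simp
      have B: "p \<in> gunits G" "p = grng G g" using units pq p by auto
      then have "gmul G (ginv G p) (gmul G g q) = gmul G g (gmul G f k)" using gG fk s by simp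
      moreover have "gmul G g (gmul G f k) \<in> E" using gG fk s B p by (intro LCL) auto
      ultimately show ?thesis by simp
    next
      fix f k assume q: "q \<in> B" and fk: "p = gmul G f k" "f \<in> F" "k \<in> L" "f \<in> arrows G" "k \<in> arrows G"
        "gsrc G f = grng G k" "gsrc G k \<in> B" "grng G f \<in> A"
      have s: "grng G g = grng G f" using fk pq by simp
      have B: "q \<in> gunits G" "q = gsrc G g" using units pq q by auto
      then have "gmul G (ginv G p) (gmul G g q) = gmul G (ginv G k) (gmul G (ginv G f) g)"
        using gG fk s by (simp add: assoc)
      moreover have "gmul G (ginv G k) (gmul G (ginv G f) g) \<in> E"
        using gG fk s B q invL subgroupoidD(3)[OF F] by (intro LCL) auto
      ultimately show ?thesis by simp
    next
      fix f k f' k' assume fk: "p = gmul G f k" "f \<in> F" "k \<in> L" "f \<in> arrows G" "k \<in> arrows G"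
        "gsrc G f = grng G k" "gsrc G k \<in> B" "grng G f \<in> A"
      and fk': "q = gmul G f' k'" "f' \<in> F" "k' \<in> L" "f' \<in> arrows G" "k' \<in> arrows G"
        "gsrc G f' = grng G k'" "gsrc G k' \<in> B" "grng G f' \<in> A"
      have s: "grng G g = grng G f" "gsrc G g = grng G f'" using fk fk' pq by auto
      then have "g \<in> F" using gG fk fk' by (intro LF) auto
      then have "gmul G g f' \<in> F" using subgroupoidD(4)[OF F] s fk' by blast
      then have "gmul G (ginv G f) (gmul G g f') \<in> F"
        using subgroupoidD(3,4)[OF F] s fk fk' gG by simp
      then have "gmul G (ginv G k) (gmul G (gmul G (ginv G f) (gmul G g f')) k') \<in> E"
        using fk fk' s gG invL by (intro LCL) auto
      moreover have "gmul G (ginv G p) (gmul G g q) = gmul G (ginv G k) (gmul G (gmul G (ginv G f) (gmul G g f')) k')"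
        using gG fk fk' s by (simp add: assoc)
      ultimately show ?thesis by simp
    qed
  qed
  moreover obtain D where D: "compactin (gtop G) D" "E \<subseteq> D" using tame unfolding tame_def E_def by blast
  define Q where "Q = B \<union> prods G C L"
  have "P \<subseteq> Q" unfolding P_def Q_def using prods_mono[OF FC subset_refl, of G L] by blast
  then have "prods G P (prods G E (ginv G ` P)) \<subseteq> prods G Q (prods G D (ginv G ` Q))"
    using D(2) by (intro prods_mono image_mono)
  moreover have "compactin (gtop G) (C \<union> prods G Q (prods G D (ginv G ` Q)))"
    unfolding Q_def by (intro compactin_Un compactin_prods compactin_inverses C D L Bc)
  ultimately show ?thesis unfolding tame_def using FC by (meson Un_mono order_trans)
qed

text \<open>
  The order of choice matters: the cover of \<open>B\<close> is taken with respect to the excursions that the cover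
  of \<open>A\<close> makes possible.
\<close>

lemma dad_over_Un:
  assumes A: "compactin (gtop G) A" "A \<subseteq> gunits G" "dad_over G A d"
    and B: "compactin (gtop G) B" "B \<subseteq> gunits G" "dad_over G B d"
  shows "dad_over G (A \<union> B) d"
  unfolding dad_over_def
proof (intro allI impI)
  fix K assume K: "compactin (gtop G) K"
  define L where "L = K \<union> ginv G ` K \<union> (A \<union> B)"
  have L: "compactin (gtop G) L" unfolding L_def by (intro compactin_Un K compactin_inverses A B)
  have Linv: "ginv G ` L \<subseteq> L"
    unfolding L_def using compactin_arrows[OF K] A(2) B(2) by (auto simp: subset_iff)
  obtain A' where A': "\<forall>i\<le>d. compactin (gtop G) (A' i) \<and> tame G L (A' i)" "A = (\<Union>i\<le>d. A' i)"
    using A(3) L unfolding dad_over_def by blast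
  have "\<forall>i\<in>{..d}. \<exists>C. compactin (gtop G) C \<and> generated_subgroupoid G (over G L (A' i)) \<subseteq> C"
    using A'(1) unfolding tame_def by blast
  from bchoice[OF this] obtain C' where C': "\<And>i. i \<le> d \<Longrightarrow> compactin (gtop G) (C' i) \<and> generated_subgroupoid G (over G L (A' i)) \<subseteq> C' i"
    by auto
  define C where "C = (\<Union>i\<le>d. C' i)"
  have C: "compactin (gtop G) C" unfolding C_def using C' by (intro compactin_Union) auto
  have "compactin (gtop G) (L \<union> prods G L (prods G C L))"
    by (intro compactin_Un compactin_prods L C)
  then obtain B' where B': "\<forall>i\<le>d. compactin (gtop G) (B' i) \<and> tame G (L \<union> prods G L (prods G C L)) (B' i)"
    "B = (\<Union>i\<le>d. B' i)"
    using B(3) unfolding dad_over_def by blast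
  show "\<exists>D. (\<forall>i\<le>d. compactin (gtop G) (D i) \<and> tame G K (D i)) \<and> A \<union> B = (\<Union>i\<le>d. D i)"
  proof (intro exI conjI allI impI)
    show "compactin (gtop G) (A' i \<union> B' i)" if "i \<le> d" for i
      using that A' B' by (intro compactin_Un) auto
    show "A \<union> B = (\<Union>i\<le>d. A' i \<union> B' i)" using A'(2) B'(2) by blast
    show "tame G K (A' i \<union> B' i)" if i: "i \<le> d" for i
    proof -
      have sub: "A' i \<subseteq> A" "B' i \<subseteq> B" using A'(2) B'(2) i by blast+
      have "tame G L (A' i \<union> B' i)"
      proof (rule tame_Un[OF L Linv])
        show "A' i \<union> B' i \<subseteq> L" "A' i \<subseteq> gunits G" "B' i \<subseteq> gunits G"
          using sub A(2) B(2) unfolding L_def by blast+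
        show "compactin (gtop G) (B' i)" using B' i by blast
        show "generated_subgroupoid G (over G L (A' i)) \<subseteq> C" using C'[OF i] i unfolding C_def by blast
        show "tame G (L \<union> prods G L (prods G C L)) (B' i)" using B' i by blast
      qed (rule C)
      then show ?thesis by (rule tame_mono) (auto simp only: L_def)
    qed
  qed
qed

lemma dad_over_empty: "dad_over G {} d"
  unfolding dad_over_def
proof (intro allI impI exI conjI)
  have "subgroupoid G {}" by (rule subgroupoidI) auto
  then have "generated_subgroupoid G (over G K {}) \<subseteq> {}" for K
    by (rule generated_least) (auto simp: over_def)
  then show "tame G K {}" for K unfolding tame_def using compactin_empty by blast
qed auto

lemma dad_over_Union:
  assumes "finite \<C>" "\<And>C. C \<in> \<C> \<Longrightarrow> compactin (gtop G) C \<and> C \<subseteq> gunits G \<and> dad_over G C d"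
  shows "dad_over G (\<Union>\<C>) d"
  using assms
proof (induction \<C> rule: finite_induct)
  case (insert C \<C>)
  have "compactin (gtop G) (\<Union>\<C>)" using insert by (intro compactin_Union) auto
  moreover have "\<Union>\<C> \<subseteq> gunits G" using insert.prems by blast
  ultimately show ?case using insert by (auto intro!: dad_over_Un)
qed (simp add: dad_over_empty)

end

text \<open>
  The preimages of the members of a cover of \<open>\<theta> ` A\<close> are tame because \<open>\<theta>\<close> maps the subgroupoid that
  they generate into a compact set, and \<open>\<theta>\<close> is proper.
\<close>

lemma dad_over_pullback:
  assumes "Hausdorff_groupoid G" and "Hausdorff_groupoid H"
    and A: "compactin (gtop H) A" "A \<subseteq> gunits H"
    and cont: "continuous_map (subtopology (gtop H) (over H (arrows H) A)) (gtop G) \<theta>"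
    and src: "\<And>h. h \<in> over H (arrows H) A \<Longrightarrow> gsrc G (\<theta> h) = \<theta> (gsrc H h)"
    and rng: "\<And>h. h \<in> over H (arrows H) A \<Longrightarrow> grng G (\<theta> h) = \<theta> (grng H h)"
    and mul: "\<And>h k. h \<in> over H (arrows H) A \<Longrightarrow> k \<in> over H (arrows H) A \<Longrightarrow> gsrc H h = grng H k \<Longrightarrow>
      \<theta> (gmul H h k) = gmul G (\<theta> h) (\<theta> k)"
    and proper: "\<And>C. compactin (gtop G) C \<Longrightarrow>
      \<exists>D. compactin (gtop H) D \<and> {h \<in> over H (arrows H) A. \<theta> h \<in> C} \<subseteq> D"
    and dad: "dad_over G (\<theta> ` A) d"
  shows "dad_over H A d"
proof -
  interpret G: Hausdorff_groupoid G by fact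
  interpret H: Hausdorff_groupoid H by fact
  let ?Y = "over H (arrows H) A"
  have Y: "subgroupoid H ?Y" by (rule H.subgroupoid_over)
  have YH: "h \<in> arrows H" if "h \<in> ?Y" for h using that by (simp add: over_def)
  have AY: "A \<subseteq> ?Y" using H.unit_in_over[OF A(2)] .
  have \<theta>G: "\<theta> h \<in> arrows G" if "h \<in> ?Y" for h
    using continuous_map_funspace[OF cont] that YH[OF that] unfolding arrows_def by auto
  have \<theta>inv: "\<theta> (ginv H h) = ginv G (\<theta> h)" if h: "h \<in> ?Y" for h
  proof (rule G.inverse_unique)
    have h': "ginv H h \<in> ?Y" using H.subgroupoidD(3)[OF Y h] .
    show "\<theta> h \<in> arrows G" "\<theta> (ginv H h) \<in> arrows G" using \<theta>G h h' by auto
    show "gsrc G (\<theta> (ginv H h)) = grng G (\<theta> h)" using src[OF h'] rng[OF h] YH[OF h] by simp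
    show "gmul G (\<theta> (ginv H h)) (\<theta> h) = gsrc G (\<theta> h)"
      using mul[OF h' h] src[OF h] YH[OF h] by simp
  qed
  show ?thesis
    unfolding dad_over_def
  proof (intro allI impI)
    fix K assume K: "compactin (gtop H) K"
    have oY: "over H K A \<subseteq> ?Y" using H.compactin_arrows[OF K] by (auto simp: over_def)
    have "compactin (subtopology (gtop H) ?Y) (over H K A)"
      unfolding compactin_subtopology using H.compactin_over[OF K A(1)] oY by blast
    then have "compactin (gtop G) (\<theta> ` over H K A)" using image_compactin cont by blast
    then obtain B where B: "\<forall>i\<le>d. compactin (gtop G) (B i) \<and> tame G (\<theta> ` over H K A) (B i)"
      "\<theta> ` A = (\<Union>i\<le>d. B i)"
      using dad unfolding dad_over_def by blast
    define A' where "A' i = {a \<in> A. \<theta> a \<in> B i}" for i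
    show "\<exists>B. (\<forall>i\<le>d. compactin (gtop H) (B i) \<and> tame H K (B i)) \<and> A = (\<Union>i\<le>d. B i)"
    proof (intro exI conjI allI impI)
      show "A = (\<Union>i\<le>d. A' i)" unfolding A'_def using B(2) by blast
      show "compactin (gtop H) (A' i)" if "i \<le> d" for i
      proof -
        have contA: "continuous_map (subtopology (gtop H) A) (gtop G) \<theta>"
          using continuous_map_from_subtopology_mono[OF cont AY] .
        have top: "topspace (subtopology (gtop H) A) = A"
          using compactin_subset_topspace[OF A(1)] by auto
        have "closedin (gtop G) (B i)" using B(1) that G.Hausdorff_arrows compactin_imp_closedin by blast
        then have "closedin (subtopology (gtop H) A) {a \<in> topspace (subtopology (gtop H) A). \<theta> a \<in> B i}"
          by (rule closedin_continuous_map_preimage[OF contA])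
        then have "compactin (subtopology (gtop H) A) (A' i)"
          unfolding top A'_def by (rule closedin_compact_space[OF compact_space_subtopology[OF A(1)]])
        then show ?thesis by (simp add: compactin_subtopology)
      qed
      show "tame H K (A' i)" if "i \<le> d" for i
      proof -
        define E where "E = generated_subgroupoid G (over G (\<theta> ` over H K A) (B i))"
        obtain C where C: "compactin (gtop G) C" "E \<subseteq> C"
        proof -
          have "tame G (\<theta> ` over H K A) (B i)" using B(1) \<open>i \<le> d\<close> by blast
          then show ?thesis using that unfolding tame_def E_def[symmetric] by blast
        qed
        obtain D where D: "compactin (gtop H) D" "{h \<in> ?Y. \<theta> h \<in> C} \<subseteq> D" using proper[OF C(1)] by blast
        have "\<theta> ` over H K A \<subseteq> arrows G" using \<theta>G oY by blast
        then have E: "subgroupoid G E"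
          unfolding E_def by (intro G.subgroupoid_generated G.over_arrows)
        have "subgroupoid H {h \<in> ?Y. \<theta> h \<in> E}"
        proof (rule H.subgroupoidI)
          show "ginv H h \<in> {h \<in> ?Y. \<theta> h \<in> E}" if "h \<in> {h \<in> ?Y. \<theta> h \<in> E}" for h
            using that \<theta>inv G.subgroupoidD(3)[OF E] H.subgroupoidD(3)[OF Y] by simp
          show "gmul H h k \<in> {h \<in> ?Y. \<theta> h \<in> E}"
            if "h \<in> {h \<in> ?Y. \<theta> h \<in> E}" "k \<in> {h \<in> ?Y. \<theta> h \<in> E}" "gsrc H h = grng H k" for h k
          proof -
            have h: "h \<in> ?Y" "k \<in> ?Y" "\<theta> h \<in> E" "\<theta> k \<in> E" using that by auto
            then have "gsrc G (\<theta> h) = grng G (\<theta> k)" using src rng that(3) by simp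
            then have "gmul G (\<theta> h) (\<theta> k) \<in> E" using h G.subgroupoidD(4)[OF E] by blast
            then show ?thesis using mul[OF h(1,2) that(3)] H.subgroupoidD(4)[OF Y h(1,2) that(3)] by simp
          qed
        qed (use YH in blast)
        moreover have "over H K (A' i) \<subseteq> {h \<in> ?Y. \<theta> h \<in> E}"
        proof
          fix h assume h: "h \<in> over H K (A' i)"
          then have hK: "h \<in> over H K A" unfolding over_def A'_def by blast
          then have hY: "h \<in> ?Y" using oY by blast
          have "gsrc G (\<theta> h) \<in> B i" "grng G (\<theta> h) \<in> B i"
            using h src[OF hY] rng[OF hY] unfolding over_def A'_def by auto
          then have "\<theta> h \<in> over G (\<theta> ` over H K A) (B i)" using hK unfolding over_def[of G] by blast
          then have "\<theta> h \<in> E" unfolding E_def using G.generated_superset by blast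
          then show "h \<in> {h \<in> ?Y. \<theta> h \<in> E}" using hY by blast
        qed
        ultimately have "generated_subgroupoid H (over H K (A' i)) \<subseteq> {h \<in> ?Y. \<theta> h \<in> E}"
          by (rule H.generated_least)
        then show ?thesis unfolding tame_def using C(2) D by blast
      qed
    qed
  qed
qed

section \<open>Kolmogorov's multiplicity argument\<close>

context topological_groupoid
begin

text \<open>
  Each unit carries a set of labels that is constant along the generators. A product of generators
  then lies in every \<open>F i\<close> whose label \<open>i\<close> occurs along it.
\<close>

lemma generated_subset_of_labelling:
  assumes S: "S \<subseteq> arrows G" and F: "\<And>i. i \<in> I \<Longrightarrow> subgroupoid G (F i)"
    and lab: "\<And>g. g \<in> S \<Longrightarrow> T (gsrc G g) = T (grng G g) \<and> T (grng G g) \<noteq> {} \<and> T (grng G g) \<subseteq> I"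
    and mem: "\<And>g i. g \<in> S \<Longrightarrow> i \<in> T (grng G g) \<Longrightarrow> g \<in> F i"
  shows "generated_subgroupoid G S \<subseteq> (\<Union>i\<in>I. F i)"
proof -
  define Q where "Q = {g \<in> arrows G. T (gsrc G g) = T (grng G g) \<and> T (grng G g) \<noteq> {} \<and> T (grng G g) \<subseteq> I \<and>
    (\<forall>i\<in>T (grng G g). g \<in> F i)}"
  have "subgroupoid G Q"
  proof (rule subgroupoidI)
    show "ginv G g \<in> Q" if "g \<in> Q" for g
    proof -
      have g: "g \<in> arrows G" "T (gsrc G g) = T (grng G g)" "T (grng G g) \<noteq> {}" "T (grng G g) \<subseteq> I"
        and gF: "\<And>i. i \<in> T (grng G g) \<Longrightarrow> g \<in> F i"
        using that unfolding Q_def by blast+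
      have "ginv G g \<in> F i" if "i \<in> T (grng G g)" for i
        using that g(4) gF subgroupoidD(3)[OF F] by blast
      then show ?thesis using g unfolding Q_def by simp
    qed
    show "gmul G g h \<in> Q" if "g \<in> Q" "h \<in> Q" and s: "gsrc G g = grng G h" for g h
    proof -
      have g: "g \<in> arrows G" "T (gsrc G g) = T (grng G g)" "T (grng G g) \<noteq> {}" "T (grng G g) \<subseteq> I"
        and gF: "\<And>i. i \<in> T (grng G g) \<Longrightarrow> g \<in> F i"
        and h: "h \<in> arrows G" "T (gsrc G h) = T (grng G h)"
        and hF: "\<And>i. i \<in> T (grng G h) \<Longrightarrow> h \<in> F i"
        using that unfolding Q_def by blast+
      have "gmul G g h \<in> F i" if i: "i \<in> T (grng G g)" for i
      proof (rule subgroupoidD(4)[OF F])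
        show "i \<in> I" using i g(4) by blast
        show "g \<in> F i" using gF[OF i] .
        show "h \<in> F i" using hF i g(2) s by simp
      qed (rule s)
      then show ?thesis using g h s unfolding Q_def by simp
    qed
  qed (auto simp: Q_def)
  moreover have "S \<subseteq> Q"
  proof
    fix g assume "g \<in> S"
    then show "g \<in> Q" using lab[of g] mem[of g] S unfolding Q_def by blast
  qed
  ultimately have "generated_subgroupoid G S \<subseteq> Q" by (rule generated_least)
  also have "Q \<subseteq> (\<Union>i\<in>I. F i)" unfolding Q_def by blast
  finally show ?thesis .
qed

end

context Hausdorff_groupoid
begin

text \<open>
  Conjugation by single steps moves the neighbourhood of \<open>B\<close> into \<open>B\<close> and turns one step into three.
\<close>

lemma tame_neighbourhood:
  assumes L: "compactin (gtop G) L" "ginv G ` L \<subseteq> L"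
    and tame: "tame G (prods G L (prods G L L)) B"
  shows "tame G L (grng G ` {k \<in> L. gsrc G k \<in> B})"
proof -
  let ?K = "prods G L (prods G L L)"
  define P where "P = {k \<in> L. gsrc G k \<in> B}"
  define E where "E = generated_subgroupoid G (over G ?K B)"
  have LG: "L \<subseteq> arrows G" using L(1) compactin_arrows by auto
  have PG: "P \<subseteq> arrows G" using LG unfolding P_def by blast
  have KG: "?K \<subseteq> arrows G" using LG by (simp add: prods_arrows)
  have E: "subgroupoid G E" unfolding E_def using over_arrows[OF KG] by (rule subgroupoid_generated)
  have "subgroupoid G {}" by (rule subgroupoidI) auto
  then have "generated_subgroupoid G (over G L (grng G ` P)) \<subseteq> {} \<union> prods G P (prods G E (ginv G ` P))"
  proof (rule generated_subset_of_conjugation[OF _ E PG over_arrows[OF LG]])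
    fix g p q assume g: "g \<in> over G L (grng G ` P)"
      and pq: "p \<in> P" "q \<in> P" "grng G p = grng G g" "grng G q = gsrc G g"
    have mem: "g \<in> L" "g \<in> arrows G" "p \<in> arrows G" "q \<in> arrows G" "ginv G p \<in> L" "q \<in> L"
      using g pq LG L(2) unfolding P_def over_def by blast+
    have "gmul G g q \<in> prods G L L" using mem pq by (intro prodsI) auto
    then have "gmul G (ginv G p) (gmul G g q) \<in> ?K"
      by (rule prodsI[OF mem(5)]) (use mem pq in simp)
    then have "gmul G (ginv G p) (gmul G g q) \<in> over G ?K B"
      using mem pq unfolding over_def P_def by simp
    then show "gmul G (ginv G p) (gmul G g q) \<in> E"
      unfolding E_def using generated_superset[of "over G ?K B"] by blast
  qed (auto simp: over_def)
  moreover obtain D where D: "compactin (gtop G) D" "E \<subseteq> D" using tame unfolding tame_def E_def by blast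
  have "prods G P (prods G E (ginv G ` P)) \<subseteq> prods G L (prods G D (ginv G ` L))"
    using D(2) unfolding P_def by (intro prods_mono image_mono) auto
  moreover have "compactin (gtop G) (prods G L (prods G D (ginv G ` L)))"
    by (intro compactin_prods compactin_inverses L D)
  ultimately show ?thesis unfolding tame_def P_def[symmetric] by blast
qed

end

context etale_groupoid
begin

text \<open>
  The induction step adds one set to \<open>B 0, \<dots>, B k\<close>. Replacing each \<open>B i\<close> by an open tame set \<open>U i\<close>
  that contains all neighbours of \<open>B i\<close> raises the multiplicity, except on the compact set \<open>E\<close> of points
  at which it is still as small as allowed. At such a point the same indices \<open>i\<close> occur for \<open>B i\<close> and for
  \<open>U i\<close>. A step between two points of \<open>E\<close> leads from \<open>B i\<close> into \<open>U i\<close>, hence preserves these indices,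
  and a walk inside \<open>E\<close> stays in a single \<open>U i\<close>. So \<open>E\<close> is tame and serves as the new set. The
  neighbours are tame because the induction hypothesis is used for three steps at a time.
\<close>

lemma dad_over_multiplicity:
  assumes A: "compactin (gtop G) A" "A \<subseteq> gunits G" and dad: "dad_over G A d" and "d \<le> k"
    and "compactin (gtop G) K"
  shows "\<exists>B. (\<forall>i\<le>k. compactin (gtop G) (B i) \<and> B i \<subseteq> A \<and> tame G K (B i)) \<and>
    (\<forall>x\<in>A. k < d + card {i. i \<le> k \<and> x \<in> B i})"
  using assms(4,5)
proof (induction k arbitrary: K rule: dec_induct)
  case base
  obtain B where B: "\<forall>i\<le>d. compactin (gtop G) (B i) \<and> tame G K (B i)" "A = (\<Union>i\<le>d. B i)"
    using dad base unfolding dad_over_def by blast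
  have "d < d + card {i. i \<le> d \<and> x \<in> B i}" if "x \<in> A" for x
  proof -
    have "{i. i \<le> d \<and> x \<in> B i} \<noteq> {}" using that B(2) by blast
    then show ?thesis by (simp add: card_gt_0_iff)
  qed
  then show ?case using B by (intro exI[of _ B]) blast
next
  case (step k)
  define L where "L = K \<union> ginv G ` K \<union> A"
  have L: "compactin (gtop G) L" unfolding L_def by (intro compactin_Un step.prems compactin_inverses A)
  have Linv: "ginv G ` L \<subseteq> L"
    unfolding L_def using compactin_arrows[OF step.prems] A(2) by (auto simp: subset_iff)
  have LG: "L \<subseteq> arrows G" using compactin_arrows[OF L] .
  have "compactin (gtop G) (prods G L (prods G L L))" by (intro compactin_prods L)
  from step.IH[OF this] obtain B where
    B: "\<And>i. i \<le> k \<Longrightarrow> compactin (gtop G) (B i) \<and> B i \<subseteq> A \<and> tame G (prods G L (prods G L L)) (B i)"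
    and mult: "\<And>x. x \<in> A \<Longrightarrow> k < d + card {i. i \<le> k \<and> x \<in> B i}"
    by blast
  define N where "N i = grng G ` {g \<in> L. gsrc G g \<in> B i}" for i
  have "\<exists>U. openin (unit_space G) U \<and> N i \<subseteq> U \<and> tame G L U" if "i \<le> k" for i
  proof -
    have tameN: "tame G L (N i)" unfolding N_def using B[OF that] by (intro tame_neighbourhood L Linv) blast
    have "{g \<in> L. gsrc G g \<in> B i} = {g \<in> topspace (gtop G). gsrc G g \<in> B i} \<inter> L"
      using LG unfolding arrows_def by blast
    moreover have "closedin (gtop G) {g \<in> topspace (gtop G). gsrc G g \<in> B i}"
      using B[OF that] Hausdorff compactin_imp_closedin by (intro closedin_continuous_map_preimage[OF continuous_src]) blast
    ultimately have "compactin (gtop G) {g \<in> L. gsrc G g \<in> B i}"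
      using closed_Int_compactin[OF _ L] by simp
    then have cN: "compactin (gtop G) (N i)" unfolding N_def by (rule compactin_ranges)
    have "N i \<subseteq> gunits G" unfolding N_def using LG rng_unit by blast
    from tame_open_enlargement[OF L cN this tameN] show ?thesis by blast
  qed
  then obtain U where U: "\<And>i. i \<le> k \<Longrightarrow> openin (unit_space G) (U i) \<and> N i \<subseteq> U i \<and> tame G L (U i)"
    by metis
  have BU: "B i \<subseteq> U i" if "i \<le> k" for i
  proof
    fix x assume x: "x \<in> B i"
    then have "x \<in> L" "gsrc G x = x" "grng G x = x" using B[OF that] A(2) unfolding L_def by auto
    then have "x \<in> N i" unfolding N_def using x by (metis (mono_tags, lifting) imageI mem_Collect_eq)
    then show "x \<in> U i" using U[OF that] by blast
  qed
  define T where "T x = {i. i \<le> k \<and> x \<in> B i}" for x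
  define R where "R x = {i. i \<le> k \<and> x \<in> U i}" for x
  define E where "E = {x \<in> A. d + card (R x) \<le> Suc k}"
  have finR: "finite (R x)" for x unfolding R_def by simp
  have TR: "T x \<subseteq> R x" for x using BU unfolding T_def R_def by blast
  have ET: "T x = R x" if "x \<in> E" for x
  proof (rule card_seteq[OF finR TR])
    show "card (R x) \<le> card (T x)" using that mult[of x] unfolding E_def T_def by auto
  qed
  have "closedin (subtopology (gtop G) A) E"
  proof -
    have top: "topspace (subtopology (gtop G) A) = A" using compactin_subset_topspace[OF A(1)] by auto
    have "\<exists>V. openin (subtopology (gtop G) A) V \<and> x \<in> V \<and> V \<subseteq> A - E" if x: "x \<in> A - E" for x
    proof (intro exI conjI)
      let ?V = "A \<inter> (\<Inter>i\<in>R x. A \<inter> U i)"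
      show "openin (subtopology (gtop G) A) ?V"
      proof (cases "R x = {}")
        case False
        have "openin (subtopology (gtop G) A) (\<Inter>i\<in>R x. A \<inter> U i)"
          using finR False U A(2) by (intro openin_Inter) (auto simp: R_def intro!: openin_unit_space_trace)
        then show ?thesis using openin_topspace[of "subtopology (gtop G) A"] unfolding top by blast
      next
        case True
        then show ?thesis using openin_topspace[of "subtopology (gtop G) A"] unfolding top by simp
      qed
      show "x \<in> ?V" using x unfolding R_def by blast
      show "?V \<subseteq> A - E"
      proof
        fix y assume y: "y \<in> ?V"
        then have "R x \<subseteq> R y" unfolding R_def by blast
        then have "card (R x) \<le> card (R y)" using finR card_mono by blast
        then show "y \<in> A - E" using x y unfolding E_def by auto
      qed
    qed
    then have "openin (subtopology (gtop G) A) (A - E)"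
      by (subst openin_subopen) blast
    moreover have "E \<subseteq> A" unfolding E_def by blast
    ultimately show ?thesis unfolding closedin_def top by blast
  qed
  then have "compactin (subtopology (gtop G) A) E"
    by (rule closedin_compact_space[OF compact_space_subtopology[OF A(1)]])
  \<comment> \<open>The set of points of low multiplicity is closed because membership in the open sets \<open>U i\<close> persists nearby.\<close>
  then have cE: "compactin (gtop G) E" "E \<subseteq> A" by (simp_all add: compactin_subtopology)
  have tameE: "tame G L E"
  proof -
    have "\<forall>i\<in>{..k}. \<exists>C. compactin (gtop G) C \<and> generated_subgroupoid G (over G L (U i)) \<subseteq> C"
      using U unfolding tame_def by blast
    from bchoice[OF this] obtain C where C: "\<And>i. i \<le> k \<Longrightarrow> compactin (gtop G) (C i) \<and>
        generated_subgroupoid G (over G L (U i)) \<subseteq> C i" by auto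
    \<comment> \<open>A step inside \<open>E\<close> can only gain labels, and its inverse gives the other inclusion.\<close>
    have move: "T (gsrc G g) \<subseteq> T (grng G g)" if g: "g \<in> over G L E" for g
    proof
      fix i assume "i \<in> T (gsrc G g)"
      then have i: "i \<le> k" "gsrc G g \<in> B i" unfolding T_def by blast+
      then have "grng G g \<in> N i" using g unfolding N_def over_def by blast
      then have "i \<in> R (grng G g)" using U[OF i(1)] i(1) unfolding R_def by blast
      then show "i \<in> T (grng G g)" using ET g unfolding over_def by blast
    qed
    have "generated_subgroupoid G (over G L E) \<subseteq> (\<Union>i\<in>{..k}. generated_subgroupoid G (over G L (U i)))"
    proof (rule generated_subset_of_labelling[where T = T])
      fix g assume g: "g \<in> over G L E"
      then have gG: "g \<in> arrows G" using LG unfolding over_def by blast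
      have "ginv G g \<in> over G L E" using g gG Linv unfolding over_def by auto
      from move[OF this] move[OF g] gG have eq: "T (gsrc G g) = T (grng G g)" by simp
      have "grng G g \<in> A" using g cE(2) unfolding over_def by blast
      then have "card (T (grng G g)) \<noteq> 0" using mult[of "grng G g"] \<open>d \<le> k\<close> unfolding T_def by linarith
      then show "T (gsrc G g) = T (grng G g) \<and> T (grng G g) \<noteq> {} \<and> T (grng G g) \<subseteq> {..k}"
        using eq unfolding T_def by auto
      show "g \<in> generated_subgroupoid G (over G L (U i))" if "i \<in> T (grng G g)" for i
      proof -
        have "i \<in> T (gsrc G g)" using that eq by simp
        then have "gsrc G g \<in> U i" "grng G g \<in> U i" using that BU unfolding T_def by blast+
        then have "g \<in> over G L (U i)" using g unfolding over_def by blast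
        then show ?thesis using generated_superset[of "over G L (U i)"] by blast
      qed
    qed (auto intro!: over_arrows subgroupoid_generated LG)
    also have "\<dots> \<subseteq> (\<Union>i\<in>{..k}. C i)" using C by blast
    finally show ?thesis
      unfolding tame_def using C by (intro exI[of _ "\<Union>i\<in>{..k}. C i"] conjI compactin_Union) auto
  qed
  have "E \<subseteq> gunits G" using cE(2) A(2) by blast
  then obtain W where W: "openin (unit_space G) W" "E \<subseteq> W" "tame G L W"
    using tame_open_enlargement[OF L cE(1) _ tameE] by blast
  define V where "V i = (if i \<le> k then U i else W)" for i
  have V: "openin (unit_space G) (V i) \<and> tame G L (V i)" for i
    unfolding V_def using U W by simp
  have many: "Suc k < d + card {i. i \<le> Suc k \<and> y \<in> V i}" if y: "y \<in> A" for y
  proof (cases "y \<in> E")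
    case True
    have "{i. i \<le> Suc k \<and> y \<in> V i} = insert (Suc k) (R y)"
      using True W(2) unfolding V_def R_def by auto
    then have "card {i. i \<le> Suc k \<and> y \<in> V i} = Suc (card (R y))"
      using finR by (simp add: R_def)
    then show ?thesis using mult[OF y] ET[OF True] unfolding T_def by simp
  next
    case False
    have "R y \<subseteq> {i. i \<le> Suc k \<and> y \<in> V i}" unfolding V_def R_def by auto
    then have "card (R y) \<le> card {i. i \<le> Suc k \<and> y \<in> V i}" by (intro card_mono) auto
    then show ?thesis using False y unfolding E_def by auto
  qed
  have Vcov: "\<exists>i\<in>{..Suc k}. y \<in> V i" if "y \<in> A" for y
  proof (rule ccontr)
    assume "\<not> ?thesis"
    then have none: "{i. i \<le> Suc k \<and> y \<in> V i} = {}" by blast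
    show False using many[OF that] \<open>d \<le> k\<close> unfolding none by simp
  qed
  have Vop: "openin (subtopology (gtop G) A) (A \<inter> V i)" if "i \<in> {..Suc k}" for i
    using V[of i] A(2) by (intro openin_unit_space_trace) auto
  obtain B' where B': "\<And>i. compactin (gtop G) (B' i) \<and> B' i \<subseteq> A \<inter> V i"
    "\<And>x. x \<in> A \<Longrightarrow> \<exists>y\<in>A. \<forall>i\<in>{..Suc k}. y \<in> V i \<longrightarrow> x \<in> B' i"
    by (rule compactin_open_family_shrinking[OF Hausdorff A(1) finite_atMost Vop Vcov]) blast+
  show ?case
  proof (intro exI conjI allI impI ballI)
    show "compactin (gtop G) (B' i)" "B' i \<subseteq> A" for i using B'(1) by blast+
    have "K \<subseteq> L" unfolding L_def by blast
    moreover have "B' i \<subseteq> V i" for i using B'(1) by blast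
    ultimately show "tame G K (B' i)" for i using tame_mono V by blast
    fix x assume "x \<in> A"
    then obtain y where y: "y \<in> A" "\<forall>i\<in>{..Suc k}. y \<in> V i \<longrightarrow> x \<in> B' i" using B'(2) by blast
    then have "{i. i \<le> Suc k \<and> y \<in> V i} \<subseteq> {i. i \<le> Suc k \<and> x \<in> B' i}" by auto
    then have "card {i. i \<le> Suc k \<and> y \<in> V i} \<le> card {i. i \<le> Suc k \<and> x \<in> B' i}"
      by (intro card_mono) auto
    then show "Suc k < d + card {i. i \<le> Suc k \<and> x \<in> B' i}" using many[OF y(1)] by simp
  qed
qed

lemma dad_over_open_multiplicity:
  assumes A: "compactin (gtop G) A" "A \<subseteq> gunits G" and dad: "dad_over G A d" and "d \<le> k"
    and K: "compactin (gtop G) K"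
  obtains U where "\<And>i. i \<le> k \<Longrightarrow> openin (unit_space G) (U i) \<and> tame G K (U i)"
    and "\<And>x. x \<in> A \<Longrightarrow> k < d + card {i. i \<le> k \<and> x \<in> U i}"
proof -
  obtain B where B: "\<And>i. i \<le> k \<Longrightarrow> compactin (gtop G) (B i) \<and> B i \<subseteq> A \<and> tame G K (B i)"
    "\<And>x. x \<in> A \<Longrightarrow> k < d + card {i. i \<le> k \<and> x \<in> B i}"
    using dad_over_multiplicity[OF assms] by blast
  have "\<exists>U. openin (unit_space G) U \<and> B i \<subseteq> U \<and> tame G K U" if "i \<le> k" for i
  proof -
    have "compactin (gtop G) (B i)" "B i \<subseteq> gunits G" "tame G K (B i)" using B(1)[OF that] A(2) by blast+
    from tame_open_enlargement[OF K this] show ?thesis by blast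
  qed
  then obtain U where U: "\<And>i. i \<le> k \<Longrightarrow> openin (unit_space G) (U i) \<and> B i \<subseteq> U i \<and> tame G K (U i)"
    by metis
  show thesis
  proof (rule that)
    show "openin (unit_space G) (U i) \<and> tame G K (U i)" if "i \<le> k" for i using U[OF that] by blast
    fix x assume "x \<in> A"
    have "{i. i \<le> k \<and> x \<in> B i} \<subseteq> {i. i \<le> k \<and> x \<in> U i}" using U by blast
    then have "card {i. i \<le> k \<and> x \<in> B i} \<le> card {i. i \<le> k \<and> x \<in> U i}" by (intro card_mono) auto
    then show "k < d + card {i. i \<le> k \<and> x \<in> U i}" using B(2)[OF \<open>x \<in> A\<close>] by simp
  qed
qed

lemma dad_at_most_iff:
  "dad_at_most G d \<longleftrightarrow> (\<forall>A. compactin (gtop G) A \<and> A \<subseteq> gunits G \<longrightarrow> dad_over G A d)"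
proof -
  have "gunits G = topspace (unit_space G)"
    unfolding unit_space_def using units_arrows unfolding arrows_def by auto
  then have "openin (unit_space G) (gunits G)" using openin_topspace by metis
  from dad_at_most_restriction_iff[OF this] show ?thesis unfolding restriction_units .
qed

end

section \<open>Products\<close>

lemma openin_unit_space_product:
  assumes "openin (unit_space G) U" "openin (unit_space H) V"
  shows "openin (unit_space (product_groupoid G H)) (U \<times> V)"
proof -
  have "unit_space (product_groupoid G H) = prod_topology (unit_space G) (unit_space H)"
    unfolding unit_space_def product_groupoid_def by (simp add: subtopology_Times)
  then show ?thesis using assms by (simp add: openin_prod_Times_iff)
qed

text \<open>
  Equality fails in general, since a product of subgroupoids contains pairs of products of different
  lengths, but the upper bound is all that compactness requires.
\<close>

lemma generated_subgroupoid_product: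
  assumes "topological_groupoid G" "topological_groupoid H" "S \<subseteq> arrows G" "T \<subseteq> arrows H"
  shows "generated_subgroupoid (product_groupoid G H) (S \<times> T) \<subseteq> generated_subgroupoid G S \<times> generated_subgroupoid H T"
proof -
  interpret G: topological_groupoid G by fact
  interpret H: topological_groupoid H by fact
  let ?P = "product_groupoid G H"
  define E where "E = generated_subgroupoid G S"
  define F where "F = generated_subgroupoid H T"
  have E: "subgroupoid G E" and F: "subgroupoid H F"
    unfolding E_def F_def using G.subgroupoid_generated H.subgroupoid_generated assms by blast+
  have "subgroupoid ?P (E \<times> F)"
    unfolding subgroupoid_def
  proof (intro conjI ballI impI)
    have "arrows ?P = arrows G \<times> arrows H" by (simp add: arrows_def product_groupoid_def)
    then show "E \<times> F \<subseteq> arrows ?P" using G.subgroupoidD(1)[OF E] H.subgroupoidD(1)[OF F] by blast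
    show "ginv ?P p \<in> E \<times> F" if "p \<in> E \<times> F" for p
      using that G.subgroupoidD(3)[OF E] H.subgroupoidD(3)[OF F] by (auto simp: product_groupoid_def)
    show "gmul ?P p q \<in> E \<times> F" if "p \<in> E \<times> F" "q \<in> E \<times> F" "(p, q) \<in> composable_pairs ?P" for p q
    proof -
      obtain g h g' h' where pq: "p = (g, h)" "q = (g', h')" by (metis surj_pair)
      have "gsrc G g = grng G g'" "gsrc H h = grng H h'"
        using that(3) unfolding pq composable_pairs_def by (simp_all add: product_groupoid_def)
      then have "gmul G g g' \<in> E" "gmul H h h' \<in> F"
        using that(1,2) G.subgroupoidD(4)[OF E] H.subgroupoidD(4)[OF F] unfolding pq by blast+
      then show ?thesis unfolding pq by (simp add: product_groupoid_def)
    qed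
  qed
  moreover have "S \<times> T \<subseteq> E \<times> F"
    unfolding E_def F_def using G.generated_superset H.generated_superset by blast
  ultimately show ?thesis
    unfolding E_def[symmetric] F_def[symmetric] generated_subgroupoid_def[of ?P] by (intro hull_minimal)
qed

lemma dad_at_most_product:
  assumes G: "etale_groupoid G" and H: "etale_groupoid H" and m: "dad_at_most G m" and n: "dad_at_most H n"
  shows "dad_at_most (product_groupoid G H) (m + n)"
proof -
  interpret G: etale_groupoid G by fact
  interpret H: etale_groupoid H by fact
  let ?P = "product_groupoid G H" and ?k = "m + n"
  have topP: "gtop ?P = prod_topology (gtop G) (gtop H)"
    and srcP: "gsrc ?P = (\<lambda>(g, h). (gsrc G g, gsrc H h))" and rngP: "grng ?P = (\<lambda>(g, h). (grng G g, grng H h))"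
    by (simp_all add: product_groupoid_def)
  have Haus: "Hausdorff_space (gtop ?P)"
    unfolding topP using G.Hausdorff H.Hausdorff by (simp add: Hausdorff_space_prod_topology)
  show ?thesis
    unfolding dad_at_most_def
  proof (intro allI impI)
    fix K assume "openin (gtop ?P) K \<and> relatively_compact (gtop ?P) K"
    then obtain C where C: "compactin (gtop ?P) C" "K \<subseteq> C"
      using relatively_compact_iff_subset_compact[OF Haus] by blast
    define C1 where "C1 = fst ` C"
    define C2 where "C2 = snd ` C"
    have C1: "compactin (gtop G) C1" and C2: "compactin (gtop H) C2"
      unfolding C1_def C2_def using C(1)[unfolded topP] image_compactin continuous_map_fst continuous_map_snd by blast+
    have KC: "K \<subseteq> C1 \<times> C2" unfolding C1_def C2_def using C(2) by force
    have C1G: "C1 \<subseteq> arrows G" and C2H: "C2 \<subseteq> arrows H"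
      using G.compactin_arrows[OF C1] H.compactin_arrows[OF C2] .
    define A1 where "A1 = gsrc G ` C1 \<union> grng G ` C1"
    define A2 where "A2 = gsrc H ` C2 \<union> grng H ` C2"
    have A1: "compactin (gtop G) A1" "A1 \<subseteq> gunits G"
      unfolding A1_def using C1G G.src_unit G.rng_unit C1
      by (auto intro!: compactin_Un G.compactin_sources G.compactin_ranges)
    have A2: "compactin (gtop H) A2" "A2 \<subseteq> gunits H"
      unfolding A2_def using C2H H.src_unit H.rng_unit C2
      by (auto intro!: compactin_Un H.compactin_sources H.compactin_ranges)
    have dad1: "dad_over G A1 m" using m A1 G.dad_at_most_iff by blast
    have dad2: "dad_over H A2 n" using n A2 H.dad_at_most_iff by blast
    obtain U where U: "\<And>i. i \<le> ?k \<Longrightarrow> openin (unit_space G) (U i) \<and> tame G C1 (U i)"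
      "\<And>x. x \<in> A1 \<Longrightarrow> ?k < m + card {i. i \<le> ?k \<and> x \<in> U i}"
      by (rule G.dad_over_open_multiplicity[OF A1 dad1 le_add1 C1]) blast
    obtain V where V: "\<And>i. i \<le> ?k \<Longrightarrow> openin (unit_space H) (V i) \<and> tame H C2 (V i)"
      "\<And>x. x \<in> A2 \<Longrightarrow> ?k < n + card {i. i \<le> ?k \<and> x \<in> V i}"
      by (rule H.dad_over_open_multiplicity[OF A2 dad2 le_add2 C2]) blast
    \<comment> \<open>\<open>x\<close> lies in at least \<open>n + 1\<close> of the \<open>U i\<close> and \<open>y\<close> in at least \<open>m + 1\<close> of the \<open>V i\<close>, which is too much for disjoint index sets among \<open>m + n + 1\<close> indices.\<close>
    have cover: "\<exists>i\<le>?k. x \<in> U i \<and> y \<in> V i" if "x \<in> A1" "y \<in> A2" for x y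
    proof (rule ccontr)
      let ?I = "{i. i \<le> ?k \<and> x \<in> U i}" and ?J = "{i. i \<le> ?k \<and> y \<in> V i}"
      assume "\<not> ?thesis"
      then have "?I \<inter> ?J = {}" by blast
      then have "card ?I + card ?J = card (?I \<union> ?J)" by (simp add: card_Un_disjoint)
      also have "\<dots> \<le> card {..?k}" by (intro card_mono) auto
      finally show False using U(2)[OF that(1)] V(2)[OF that(2)] by simp
    qed
    show "\<exists>W. (\<forall>i\<le>?k. openin (unit_space ?P) (W i)) \<and>
        gsrc ?P ` K \<union> grng ?P ` K \<subseteq> (\<Union>i\<le>?k. W i) \<and>
        (\<forall>i\<le>?k. relatively_compact (gtop ?P) (generated_subgroupoid ?P (K \<inter> arrows (restriction ?P (W i)))))"
    proof (intro exI conjI allI impI)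
      show "openin (unit_space ?P) (U i \<times> V i)" if "i \<le> ?k" for i
        using U(1)[OF that] V(1)[OF that] by (intro openin_unit_space_product) auto
      show "gsrc ?P ` K \<union> grng ?P ` K \<subseteq> (\<Union>i\<le>?k. U i \<times> V i)"
      proof
        fix z assume "z \<in> gsrc ?P ` K \<union> grng ?P ` K"
        then have "z \<in> A1 \<times> A2" using KC unfolding srcP rngP A1_def A2_def by auto
        then obtain x y where "z = (x, y)" "x \<in> A1" "y \<in> A2" by blast
        then show "z \<in> (\<Union>i\<le>?k. U i \<times> V i)" using cover[of x y] by blast
      qed
      show "relatively_compact (gtop ?P) (generated_subgroupoid ?P (K \<inter> arrows (restriction ?P (U i \<times> V i))))"
        if "i \<le> ?k" for i
      proof -
        obtain D1 where D1: "compactin (gtop G) D1" "generated_subgroupoid G (over G C1 (U i)) \<subseteq> D1"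
          using U(1)[OF \<open>i \<le> ?k\<close>] unfolding tame_def by blast
        obtain D2 where D2: "compactin (gtop H) D2" "generated_subgroupoid H (over H C2 (V i)) \<subseteq> D2"
          using V(1)[OF \<open>i \<le> ?k\<close>] unfolding tame_def by blast
        have "K \<inter> arrows (restriction ?P (U i \<times> V i)) \<subseteq> over G C1 (U i) \<times> over H C2 (V i)"
          using KC by (auto simp: arrows_def restriction_def over_def srcP rngP)
        then have "generated_subgroupoid ?P (K \<inter> arrows (restriction ?P (U i \<times> V i)))
            \<subseteq> generated_subgroupoid ?P (over G C1 (U i) \<times> over H C2 (V i))"
          unfolding generated_subgroupoid_def by (rule hull_mono)
        also have "\<dots> \<subseteq> generated_subgroupoid G (over G C1 (U i)) \<times> generated_subgroupoid H (over H C2 (V i))"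
          by (intro generated_subgroupoid_product G.topological_groupoid_axioms H.topological_groupoid_axioms
              G.over_arrows H.over_arrows C1G C2H)
        also have "\<dots> \<subseteq> D1 \<times> D2" using D1(2) D2(2) by blast
        finally show ?thesis
          unfolding relatively_compact_iff_subset_compact[OF Haus]
          using D1(1) D2(1) by (intro exI[of _ "D1 \<times> D2"]) (simp add: topP compactin_Times)
      qed
    qed
  qed
qed

section \<open>Open covers and the value of the dimension\<close>

lemma dad_at_most_mono:
  assumes "dad_at_most G d" "d \<le> e"
  shows "dad_at_most G e"
  unfolding dad_at_most_def
proof (intro allI impI)
  fix K assume K: "openin (gtop G) K \<and> relatively_compact (gtop G) K"
  let ?good = "\<lambda>V. relatively_compact (gtop G) (generated_subgroupoid G (K \<inter> arrows (restriction G V)))"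
  obtain U where U: "\<forall>i\<le>d. openin (unit_space G) (U i)"
    "gsrc G ` K \<union> grng G ` K \<subseteq> (\<Union>i\<le>d. U i)" "\<forall>i\<le>d. ?good (U i)"
    using assms(1)[unfolded dad_at_most_def, rule_format, OF K] by (elim exE conjE) (rule that)
  have "?good {}"
  proof -
    have "K \<inter> arrows (restriction G {}) = {}" by (simp add: arrows_def restriction_def)
    moreover have "subgroupoid G {}" by (simp add: subgroupoid_def)
    then have "generated_subgroupoid G {} = {}" unfolding generated_subgroupoid_def by (rule hull_same)
    ultimately show ?thesis by (simp add: relatively_compact_def)
  qed
  \<comment> \<open>The cover is padded with empty sets.\<close>
  then show "\<exists>U. (\<forall>i\<le>e. openin (unit_space G) (U i)) \<and> gsrc G ` K \<union> grng G ` K \<subseteq> (\<Union>i\<le>e. U i) \<and>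
      (\<forall>i\<le>e. ?good (U i))"
  proof (intro exI[of _ "\<lambda>i. if i \<le> d then U i else {}"] conjI allI impI)
    show "gsrc G ` K \<union> grng G ` K \<subseteq> (\<Union>i\<le>e. if i \<le> d then U i else {})"
    proof
      fix x assume "x \<in> gsrc G ` K \<union> grng G ` K"
      then obtain i where "i \<le> d" "x \<in> U i" using U(2) by blast
      then show "x \<in> (\<Union>i\<le>e. if i \<le> d then U i else {})" using assms(2) by (intro UN_I[of i]) auto
    qed
  qed (use U in auto)
qed

lemma dad_le_iff: "dad G \<le> enat d \<longleftrightarrow> dad_at_most G d"
proof
  assume le: "dad G \<le> enat d"
  then have ex: "\<exists>e. dad_at_most G e" unfolding dad_def by (auto split: if_splits)
  then have "dad_at_most G (LEAST e. dad_at_most G e)" by (rule LeastI_ex)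
  moreover have "(LEAST e. dad_at_most G e) \<le> d" using le ex unfolding dad_def by simp
  ultimately show "dad_at_most G d" by (rule dad_at_most_mono)
next
  assume "dad_at_most G d"
  then show "dad G \<le> enat d" unfolding dad_def by (auto intro: Least_le)
qed

lemma enat_eqI_le:
  assumes "\<And>d. x \<le> enat d \<longleftrightarrow> y \<le> enat d"
  shows "x = y"
proof (cases x)
  case (enat m)
  then have "y \<le> enat m" using assms[of m] by simp
  moreover from this obtain n where n: "y = enat n" using enat_ile by blast
  then have "x \<le> y" using assms[of n] by simp
  ultimately show ?thesis using enat by simp
next
  case infinity
  then have "\<not> y \<le> enat d" for d using assms[of d] by simp
  then have "y = \<infinity>" by (cases y) auto
  then show ?thesis using infinity by simp
qed

text \<open>
  Every compact set of units splits into finitely many compact pieces, each inside one member of the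
  cover.
\<close>

lemma dad_open_cover:
  assumes "etale_groupoid G" and \<U>: "\<And>U. U \<in> \<U> \<Longrightarrow> openin (unit_space G) U" "\<Union>\<U> = gunits G"
  shows "dad G = (SUP U\<in>\<U>. dad (restriction G U))"
proof (rule enat_eqI_le)
  interpret G: etale_groupoid G by fact
  fix d
  have "dad_at_most G d \<longleftrightarrow> (\<forall>U\<in>\<U>. dad_at_most (restriction G U) d)"
  proof (intro iffI ballI)
    fix U assume d: "dad_at_most G d" and U: "U \<in> \<U>"
    have "U \<subseteq> gunits G" using U \<U>(2) by blast
    then have "\<forall>A. compactin (gtop G) A \<and> A \<subseteq> U \<longrightarrow> dad_over G A d"
      using d G.dad_at_most_iff by blast
    then show "dad_at_most (restriction G U) d"
      using G.dad_at_most_restriction_iff[OF \<U>(1)[OF U]] by blast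
  next
    assume d: "\<forall>U\<in>\<U>. dad_at_most (restriction G U) d"
    show "dad_at_most G d"
      unfolding G.dad_at_most_iff
    proof (intro allI impI)
      fix A assume A: "compactin (gtop G) A \<and> A \<subseteq> gunits G"
      have op: "openin (subtopology (gtop G) A) (A \<inter> U)" if "U \<in> \<U>" for U
        using \<U>(1)[OF that] A by (intro G.openin_unit_space_trace) auto
      have cov: "A \<subseteq> \<Union>\<U>" using A \<U>(2) by blast
      obtain \<C> where C: "finite \<C>" "\<Union>\<C> = A"
        "\<And>C. C \<in> \<C> \<Longrightarrow> compactin (gtop G) C \<and> (\<exists>U\<in>\<U>. C \<subseteq> U)"
        by (rule compactin_open_cover_compact_refinement[OF G.Hausdorff conjunct1[OF A] op cov]) blast+
      have "dad_over G (\<Union>\<C>) d"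
      proof (rule G.dad_over_Union[OF C(1)])
        fix C assume c: "C \<in> \<C>"
        then obtain U where U: "U \<in> \<U>" "C \<subseteq> U" using C(3) by blast
        have "C \<subseteq> gunits G" using c C(2) A by blast
        moreover have "dad_over G C d"
          using G.dad_at_most_restriction_iff[OF \<U>(1)[OF U(1)], of d] d U C(3)[OF c] by blast
        ultimately show "compactin (gtop G) C \<and> C \<subseteq> gunits G \<and> dad_over G C d" using C(3)[OF c] by blast
      qed
      then show "dad_over G A d" unfolding C(2) .
    qed
  qed
  then show "dad G \<le> enat d \<longleftrightarrow> (SUP U\<in>\<U>. dad (restriction G U)) \<le> enat d"
    unfolding SUP_le_iff dad_le_iff .
qed

lemma dad_product:
  assumes "etale_groupoid G" "etale_groupoid H"
  shows "dad (product_groupoid G H) \<le> dad G + dad H"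
proof (cases "dad G = \<infinity> \<or> dad H = \<infinity>")
  case False
  then obtain m n where mn: "dad G = enat m" "dad H = enat n" by auto
  then have "dad_at_most G m" "dad_at_most H n" using dad_le_iff[of G m] dad_le_iff[of H n] by simp_all
  then have "dad (product_groupoid G H) \<le> enat (m + n)"
    unfolding dad_le_iff by (rule dad_at_most_product[OF assms])
  then show ?thesis using mn by simp
qed auto

section \<open>Morita equivalence\<close>

lemma local_homeomorphism_continuous:
  assumes "local_homeomorphism X Y f"
  shows "continuous_map X Y f"
proof -
  have loc: "\<exists>U. openin X U \<and> x \<in> U \<and> continuous_map (subtopology X U) Y f" if x: "x \<in> topspace X" for x
  proof -
    obtain U where U: "openin X U" "x \<in> U" "homeomorphic_map (subtopology X U) (subtopology Y (f ` U)) f"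
      using assms x unfolding local_homeomorphism_def by blast
    have "continuous_map (subtopology X U) Y f"
      using homeomorphic_imp_continuous_map[OF U(3)] continuous_map_in_subtopology by blast
    with U show ?thesis by blast
  qed
  show ?thesis
    unfolding continuous_map_def
  proof (intro conjI allI impI)
    show "f \<in> topspace X \<rightarrow> topspace Y"
    proof
      fix x assume "x \<in> topspace X"
      then obtain U where U: "openin X U" "x \<in> U" "continuous_map (subtopology X U) Y f" using loc by blast
      have "x \<in> topspace (subtopology X U)" using U(2) \<open>x \<in> topspace X\<close> by simp
      then show "f x \<in> topspace Y" using continuous_map_funspace[OF U(3)] by blast
    qed
    fix V assume V: "openin Y V"
    have "\<exists>W. openin X W \<and> x \<in> W \<and> W \<subseteq> {x \<in> topspace X. f x \<in> V}" if x: "x \<in> {x \<in> topspace X. f x \<in> V}" for x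
    proof -
      obtain U where U: "openin X U" "x \<in> U" "continuous_map (subtopology X U) Y f" using loc x by blast
      let ?W = "{y \<in> topspace (subtopology X U). f y \<in> V}"
      have "openin (subtopology X U) ?W" by (rule openin_continuous_map_preimage[OF U(3) V])
      then have "openin X ?W" using openin_trans_full U(1) by blast
      moreover have "x \<in> ?W" using x U(2) by simp
      moreover have "?W \<subseteq> {x \<in> topspace X. f x \<in> V}" by auto
      ultimately show ?thesis by blast
    qed
    then show "openin X {x \<in> topspace X. f x \<in> V}" by (subst openin_subopen) blast
  qed
qed

lemma local_homeomorphism_local_section:
  assumes "surjective_local_homeomorphism X Y f" "y \<in> topspace Y"
  obtains W \<sigma> where "openin Y W" "y \<in> W" "continuous_map (subtopology Y W) X \<sigma>" "\<And>w. w \<in> W \<Longrightarrow> f (\<sigma> w) = w"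
proof -
  obtain x where x: "x \<in> topspace X" "f x = y"
    using assms unfolding surjective_local_homeomorphism_def by (metis imageE)
  then obtain U where U: "openin X U" "x \<in> U" "openin Y (f ` U)"
    "homeomorphic_map (subtopology X U) (subtopology Y (f ` U)) f"
    using assms(1) unfolding surjective_local_homeomorphism_def local_homeomorphism_def by blast
  then obtain \<sigma> where \<sigma>: "homeomorphic_maps (subtopology X U) (subtopology Y (f ` U)) f \<sigma>"
    using homeomorphic_map_maps by blast
  show thesis
  proof (rule that[of "f ` U" \<sigma>])
    show "continuous_map (subtopology Y (f ` U)) X \<sigma>"
      using \<sigma> unfolding homeomorphic_maps_def continuous_map_in_subtopology by blast
    show "f (\<sigma> w) = w" if "w \<in> f ` U" for w
    proof -
      have "w \<in> topspace (subtopology Y (f ` U))" using that openin_subset[OF U(3)] by auto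
      then show ?thesis using \<sigma> unfolding homeomorphic_maps_def by blast
    qed
  qed (use U x in auto)
qed

lemma blow_up_simps [simp]:
  "gsrc (blow_up G X \<psi>) (x, g, y) = (y, \<psi> y, y)"
  "grng (blow_up G X \<psi>) (x, g, y) = (x, \<psi> x, x)"
  "gmul (blow_up G X \<psi>) (x, g, y) (y', h, z) = (x, gmul G g h, z)"
  by (simp_all add: blow_up_def)

lemma blow_up_arrows:
  "(x, g, y) \<in> arrows (blow_up G X \<psi>) \<longleftrightarrow>
    x \<in> topspace X \<and> g \<in> arrows G \<and> y \<in> topspace X \<and> \<psi> x = grng G g \<and> \<psi> y = gsrc G g"
  by (auto simp: blow_up_def arrows_def)

lemma gtop_blow_up:
  "gtop (blow_up G X \<psi>) = subtopology (prod_topology X (prod_topology (gtop G) X))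
     {(x, g, y). \<psi> x = grng G g \<and> \<psi> y = gsrc G g}"
  by (simp add: blow_up_def)

lemma blow_up_closed:
  assumes "topological_groupoid G" and \<psi>: "\<psi> ` topspace X \<subseteq> gunits G"
  shows "u \<in> arrows (blow_up G X \<psi>) \<Longrightarrow> gsrc (blow_up G X \<psi>) u \<in> arrows (blow_up G X \<psi>)"
    and "u \<in> arrows (blow_up G X \<psi>) \<Longrightarrow> grng (blow_up G X \<psi>) u \<in> arrows (blow_up G X \<psi>)"
    and "(u, v) \<in> composable_pairs (blow_up G X \<psi>) \<Longrightarrow> gmul (blow_up G X \<psi>) u v \<in> arrows (blow_up G X \<psi>)"
proof -
  interpret topological_groupoid G by fact
  have un: "\<psi> x \<in> gunits G" if "x \<in> topspace X" for x using that \<psi> by blast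
  show "gsrc (blow_up G X \<psi>) u \<in> arrows (blow_up G X \<psi>)" if "u \<in> arrows (blow_up G X \<psi>)"
    using that un unit_arrow by (cases u) (simp add: blow_up_arrows)
  show "grng (blow_up G X \<psi>) u \<in> arrows (blow_up G X \<psi>)" if "u \<in> arrows (blow_up G X \<psi>)"
    using that un unit_arrow by (cases u) (simp add: blow_up_arrows)
  show "gmul (blow_up G X \<psi>) u v \<in> arrows (blow_up G X \<psi>)" if "(u, v) \<in> composable_pairs (blow_up G X \<psi>)"
  proof -
    obtain x g y y' h z where uv: "u = (x, g, y)" "v = (y', h, z)" by (metis surj_pair)
    then have "(x, g, y) \<in> arrows (blow_up G X \<psi>)" "(y, h, z) \<in> arrows (blow_up G X \<psi>)"
      using that unfolding composable_pairs_def by auto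
    then show ?thesis unfolding uv blow_up_simps blow_up_arrows by auto
  qed
qed

text \<open>
  The inverse is compared with \<open>f\<close> on sources, ranges and products of arrows of \<open>G\<close>, where
  injectivity of \<open>f\<close> can be used only if these are arrows again.
\<close>

lemma topological_groupoid_iso_inverse:
  assumes f: "topological_groupoid_iso G H f" and inv: "homeomorphic_maps (gtop G) (gtop H) f f'"
    and closed: "\<And>u. u \<in> arrows G \<Longrightarrow> gsrc G u \<in> arrows G" "\<And>u. u \<in> arrows G \<Longrightarrow> grng G u \<in> arrows G"
      "\<And>u v. (u, v) \<in> composable_pairs G \<Longrightarrow> gmul G u v \<in> arrows G"
  shows "topological_groupoid_iso H G f'"
proof -
  have f'f: "f' (f u) = u" if "u \<in> arrows G" for u
    using inv that unfolding homeomorphic_maps_def arrows_def by blast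
  have ff': "f (f' v) = v" and f'v: "f' v \<in> arrows G" if "v \<in> arrows H" for v
    using inv that unfolding homeomorphic_maps_def arrows_def by (blast dest: continuous_map_funspace)+
  have f_src: "gsrc H (f u) = f (gsrc G u)" "grng H (f u) = f (grng G u)" if "u \<in> arrows G" for u
    using f that unfolding topological_groupoid_iso_def by blast+
  have src: "gsrc G (f' v) = f' (gsrc H v)" "grng G (f' v) = f' (grng H v)" if v: "v \<in> arrows H" for v
    using f_src[OF f'v[OF v]] ff'[OF v] f'f closed(1,2)[OF f'v[OF v]] by metis+
  have "f' (gmul H v w) = gmul G (f' v) (f' w)" if vw: "(v, w) \<in> composable_pairs H" for v w
  proof -
    have v: "v \<in> arrows H" "w \<in> arrows H" "gsrc H v = grng H w" using vw unfolding composable_pairs_def by auto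
    have c: "(f' v, f' w) \<in> composable_pairs G"
      unfolding composable_pairs_def using f'v v src by simp
    then have "f (gmul G (f' v) (f' w)) = gmul H (f (f' v)) (f (f' w))"
      using f unfolding topological_groupoid_iso_def by blast
    then have "f (gmul G (f' v) (f' w)) = gmul H v w" using ff' v by simp
    then show ?thesis using f'f[OF closed(3)[OF c]] by simp
  qed
  moreover have "homeomorphic_map (gtop H) (gtop G) f'"
    using inv homeomorphic_maps_sym homeomorphic_maps_map by blast
  ultimately show ?thesis
    unfolding topological_groupoid_iso_def using src by blast
qed

text \<open>
  Over an open set with a section \<open>\<sigma>\<close> of \<open>\<phi>\<close>, an arrow \<open>h\<close> of \<open>H\<close> lifts to the arrow
  \<open>(\<sigma> (grng H h), h, \<sigma> (gsrc H h))\<close> of the blow-up. Mapping it by \<open>f\<close> to the blow-up of \<open>G\<close> and projecting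
  to the middle component gives the homomorphism \<open>\<theta> \<sigma>\<close>, along which the dimension is pulled back.
\<close>

lemma dad_at_most_blow_up_transfer:
  fixes G :: "'a groupoid_data" and H :: "'b groupoid_data" and X :: "'c topology" and Y :: "'d topology"
  assumes G: "etale_groupoid G" and H: "etale_groupoid H" and \<psi>: "continuous_map X (unit_space G) \<psi>"
    and \<phi>: "surjective_local_homeomorphism Y (unit_space H) \<phi>"
    and inv: "homeomorphic_maps (gtop (blow_up H Y \<phi>)) (gtop (blow_up G X \<psi>)) f f'"
    and iso: "topological_groupoid_iso (blow_up H Y \<phi>) (blow_up G X \<psi>) f"
    and dad: "dad_at_most G d"
  shows "dad_at_most H d"
proof -
  interpret G: etale_groupoid G by fact
  interpret H: etale_groupoid H by fact
  let ?GB = "blow_up G X \<psi>" and ?HB = "blow_up H Y \<phi>"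
  define pr :: "'c \<times> 'a \<times> 'c \<Rightarrow> 'a" where "pr u = fst (snd u)" for u
  define pr' :: "'d \<times> 'b \<times> 'd \<Rightarrow> 'b" where "pr' v = fst (snd v)" for v
  define \<theta> where "\<theta> \<sigma> h = pr (f (\<sigma> (grng H h), h, \<sigma> (gsrc H h)))" for \<sigma> h
  have f_cont: "continuous_map (gtop ?HB) (gtop ?GB) f" and f'_cont: "continuous_map (gtop ?GB) (gtop ?HB) f'"
    and f'f: "\<And>v. v \<in> arrows ?HB \<Longrightarrow> f' (f v) = v"
    using inv unfolding homeomorphic_maps_def arrows_def by blast+
  have f_arrows: "f v \<in> arrows ?GB" if "v \<in> arrows ?HB" for v
    using continuous_map_funspace[OF f_cont] that unfolding arrows_def by blast
  have f_src: "gsrc ?GB (f v) = f (gsrc ?HB v)" "grng ?GB (f v) = f (grng ?HB v)" if "v \<in> arrows ?HB" for v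
    using iso that unfolding topological_groupoid_iso_def by blast+
  have f_mul: "f (gmul ?HB v w) = gmul ?GB (f v) (f w)" if "(v, w) \<in> composable_pairs ?HB" for v w
    using iso that unfolding topological_groupoid_iso_def by blast
  have \<psi>_cont: "continuous_map X (gtop G) \<psi>"
    using \<psi> continuous_map_in_subtopology unfolding unit_space_def by blast
  have pr_cont: "continuous_map (gtop ?GB) (gtop G) pr"
    unfolding gtop_blow_up pr_def
    by (intro continuous_map_from_subtopology continuous_map_compose[OF continuous_map_snd continuous_map_fst, unfolded o_def])
  have pr'_cont: "continuous_map (gtop ?HB) (gtop H) pr'"
    unfolding gtop_blow_up pr'_def
    by (intro continuous_map_from_subtopology continuous_map_compose[OF continuous_map_snd continuous_map_fst, unfolded o_def])
  have pr_src: "pr (gsrc ?GB u) = gsrc G (pr u)" "pr (grng ?GB u) = grng G (pr u)" if "u \<in> arrows ?GB" for u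
    using that by (cases u; simp add: pr_def blow_up_arrows)+
  have pr_mul: "pr (gmul ?GB u v) = gmul G (pr u) (pr v)" for u v
    by (cases u; cases v) (simp add: pr_def)
  have local: "dad_over H C d"
    if C: "compactin (gtop H) C" "C \<subseteq> W" and W: "openin (unit_space H) W"
      and \<sigma>: "continuous_map (subtopology (unit_space H) W) Y \<sigma>" "\<And>w. w \<in> W \<Longrightarrow> \<phi> (\<sigma> w) = w" for C W \<sigma>
  proof -
    have CH: "C \<subseteq> gunits H" using C(2) H.openin_unit_space_subset[OF W] by blast
    let ?Y = "over H (arrows H) C"
    define lift where "lift h = (\<sigma> (grng H h), h, \<sigma> (gsrc H h))" for h
    have \<theta>_eq: "\<theta> \<sigma> h = pr (f (lift h))" for h unfolding \<theta>_def lift_def ..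
    have Yh: "h \<in> arrows H" "gsrc H h \<in> C" "grng H h \<in> C" "gsrc H h \<in> ?Y" "grng H h \<in> ?Y" if "h \<in> ?Y" for h
      using that H.subgroupoid_units[OF H.subgroupoid_over that] by (simp_all add: over_def)
    have \<sigma>C: "continuous_map (subtopology (gtop H) C) Y \<sigma>"
    proof -
      have "continuous_map (subtopology (gtop H) (gunits H \<inter> W)) Y \<sigma>"
        using \<sigma>(1) unfolding unit_space_def subtopology_subtopology .
      then show ?thesis by (rule continuous_map_from_subtopology_mono) (use CH C(2) in blast)
    qed
    have comp: "continuous_map (subtopology (gtop H) ?Y) Y (\<lambda>h. \<sigma> (e h))"
      if "continuous_map (gtop H) (gtop H) e" "\<And>h. h \<in> ?Y \<Longrightarrow> e h \<in> C" for e
    proof -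
      have "continuous_map (subtopology (gtop H) ?Y) (subtopology (gtop H) C) e"
      proof (rule continuous_map_into_subtopology)
        show "continuous_map (subtopology (gtop H) ?Y) (gtop H) e"
          by (rule continuous_map_from_subtopology[OF that(1)])
        show "e \<in> topspace (subtopology (gtop H) ?Y) \<rightarrow> C"
          by (rule Pi_I, rule that(2)) simp
      qed
      from continuous_map_compose[OF this \<sigma>C] show ?thesis by (simp add: o_def)
    qed
    have \<sigma>Y: "\<sigma> c \<in> topspace Y" if "c \<in> C" for c
    proof -
      have "c \<in> topspace (subtopology (gtop H) C)" using that compactin_subset_topspace[OF C(1)] by auto
      then show ?thesis using continuous_map_funspace[OF \<sigma>C] by blast
    qed
    have lift_arrows: "lift h \<in> arrows ?HB" if "h \<in> ?Y" for h
      unfolding lift_def blow_up_arrows using Yh[OF that] \<sigma>Y \<sigma>(2) C(2) by blast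
    have lift_cont: "continuous_map (subtopology (gtop H) ?Y) (gtop ?HB) lift"
      unfolding gtop_blow_up
    proof (rule continuous_map_into_subtopology)
      show "continuous_map (subtopology (gtop H) ?Y) (prod_topology Y (prod_topology (gtop H) Y)) lift"
        unfolding lift_def
        by (intro continuous_map_pairedI comp[OF H.continuous_rng] comp[OF H.continuous_src] Yh(2,3)
            continuous_map_from_subtopology[OF continuous_map_id[unfolded id_def]])
      show "lift \<in> topspace (subtopology (gtop H) ?Y) \<rightarrow> {(x, g, y). \<phi> x = grng H g \<and> \<phi> y = gsrc H g}"
        using lift_arrows unfolding lift_def blow_up_arrows by auto
    qed
    have lift_src: "gsrc ?HB (lift h) = lift (gsrc H h)" "grng ?HB (lift h) = lift (grng H h)" if "h \<in> ?Y" for h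
      using Yh(1)[OF that] lift_arrows[OF that] unfolding lift_def blow_up_arrows by simp_all
    have lift_mul: "lift (gmul H h k) = gmul ?HB (lift h) (lift k)" "(lift h, lift k) \<in> composable_pairs ?HB"
      if hk: "h \<in> ?Y" "k \<in> ?Y" "gsrc H h = grng H k" for h k
    proof -
      show "lift (gmul H h k) = gmul ?HB (lift h) (lift k)"
        using hk Yh(1) unfolding lift_def by simp
      show "(lift h, lift k) \<in> composable_pairs ?HB"
        unfolding composable_pairs_def using lift_arrows lift_src hk by simp
    qed
    show ?thesis
    proof (rule dad_over_pullback[OF G.Hausdorff_groupoid_axioms H.Hausdorff_groupoid_axioms C(1) CH, where \<theta> = "\<theta> \<sigma>"])
      show cont: "continuous_map (subtopology (gtop H) ?Y) (gtop G) (\<theta> \<sigma>)"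
        using continuous_map_compose[OF continuous_map_compose[OF lift_cont f_cont] pr_cont]
        unfolding \<theta>_eq[abs_def] o_def .
      show src: "gsrc G (\<theta> \<sigma> h) = \<theta> \<sigma> (gsrc H h)" if "h \<in> ?Y" for h
        unfolding \<theta>_eq pr_src(1)[OF f_arrows[OF lift_arrows[OF that]], symmetric]
          f_src(1)[OF lift_arrows[OF that]] lift_src(1)[OF that] ..
      show "grng G (\<theta> \<sigma> h) = \<theta> \<sigma> (grng H h)" if "h \<in> ?Y" for h
        unfolding \<theta>_eq pr_src(2)[OF f_arrows[OF lift_arrows[OF that]], symmetric]
          f_src(2)[OF lift_arrows[OF that]] lift_src(2)[OF that] ..
      show "\<theta> \<sigma> (gmul H h k) = gmul G (\<theta> \<sigma> h) (\<theta> \<sigma> k)"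
        if "h \<in> ?Y" "k \<in> ?Y" "gsrc H h = grng H k" for h k
        unfolding \<theta>_eq lift_mul(1)[OF that] f_mul[OF lift_mul(2)[OF that]] pr_mul ..
      show "dad_over G (\<theta> \<sigma> ` C) d"
      proof -
        have CY: "C \<subseteq> ?Y" by (rule H.unit_in_over[OF CH])
        have "compactin (subtopology (gtop H) ?Y) C" unfolding compactin_subtopology using C(1) CY by blast
        then have "compactin (gtop G) (\<theta> \<sigma> ` C)" using cont image_compactin by blast
        moreover have "\<theta> \<sigma> ` C \<subseteq> gunits G"
        proof
          fix g assume "g \<in> \<theta> \<sigma> ` C"
          then obtain c where c: "c \<in> C" "g = \<theta> \<sigma> c" by blast
          then have cY: "c \<in> ?Y" and "gsrc H c = c" using CY CH by auto
          then have "gsrc G g = g" using src[OF cY] c(2) by simp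
          moreover have "g \<in> arrows G"
            using continuous_map_funspace[OF pr_cont] f_arrows[OF lift_arrows[OF cY]] c(2)
            unfolding \<theta>_eq arrows_def by blast
          ultimately show "g \<in> gunits G" using G.src_unit by metis
        qed
        ultimately show ?thesis using dad G.dad_at_most_iff by blast
      qed
      show "\<exists>D. compactin (gtop H) D \<and> {h \<in> ?Y. \<theta> \<sigma> h \<in> B} \<subseteq> D" if B: "compactin (gtop G) B" for B
      proof -
        let ?X3 = "prod_topology X (prod_topology (gtop G) X)"
        have CY: "C \<subseteq> ?Y" by (rule H.unit_in_over[OF CH])
        \<comment> \<open>Over the compact set \<open>C\<close>, the outer components of the image in the blow-up of \<open>G\<close> stay in a compact set \<open>Z\<close>. So the arrows sent into \<open>B\<close> come from a compact part of that blow-up, which is the reason for properness.\<close>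
        define Z where "Z = fst ` f ` lift ` C"
        have "compactin (subtopology (gtop H) ?Y) C" unfolding compactin_subtopology using C(1) CY by blast
        then have "compactin (gtop ?GB) (f ` lift ` C)"
          by (rule image_compactin[OF image_compactin[OF _ lift_cont] f_cont])
        moreover have "continuous_map (gtop ?GB) X fst"
          unfolding gtop_blow_up by (intro continuous_map_from_subtopology continuous_map_fst)
        ultimately have Z: "compactin X Z" unfolding Z_def by (rule image_compactin)
        define M where "M = {u \<in> topspace ?X3. (\<psi> \<circ> fst) u = (grng G \<circ> pr) u} \<inter>
          {u \<in> topspace ?X3. (\<psi> \<circ> (snd \<circ> snd)) u = (gsrc G \<circ> pr) u}"
        have prX: "continuous_map ?X3 (gtop G) pr" "continuous_map ?X3 X (snd \<circ> snd)"
          unfolding pr_def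
          by (intro continuous_map_compose[OF continuous_map_snd continuous_map_fst, unfolded o_def]
              continuous_map_compose[OF continuous_map_snd continuous_map_snd])+
        have "closedin ?X3 M"
          unfolding M_def
          by (intro closedin_Int closedin_continuous_maps_eq[OF G.Hausdorff]
              continuous_map_compose[OF _ \<psi>_cont] continuous_map_compose[OF prX(1)] G.continuous_rng G.continuous_src
              continuous_map_fst prX)
        then have "compactin ?X3 (M \<inter> (Z \<times> B \<times> Z))"
          by (rule closed_Int_compactin) (simp add: compactin_Times Z B)
        moreover have M: "M \<subseteq> {(x, g, y). \<psi> x = grng G g \<and> \<psi> y = gsrc G g}"
          unfolding M_def pr_def by auto
        ultimately have "compactin (gtop ?GB) (M \<inter> (Z \<times> B \<times> Z))"
          unfolding gtop_blow_up compactin_subtopology by blast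
        then have "compactin (gtop H) (pr' ` f' ` (M \<inter> (Z \<times> B \<times> Z)))"
          by (rule image_compactin[OF image_compactin[OF _ f'_cont] pr'_cont])
        moreover have "{h \<in> ?Y. \<theta> \<sigma> h \<in> B} \<subseteq> pr' ` f' ` (M \<inter> (Z \<times> B \<times> Z))"
        proof
          fix h assume "h \<in> {h \<in> ?Y. \<theta> \<sigma> h \<in> B}"
          then have h: "h \<in> ?Y" "\<theta> \<sigma> h \<in> B" by auto
          obtain x g y where u: "f (lift h) = (x, g, y)" by (metis surj_pair)
          have arr: "(x, g, y) \<in> arrows ?GB" using f_arrows[OF lift_arrows[OF h(1)]] u by simp
          have "(y, \<psi> y, y) = f (lift (gsrc H h))" "(x, \<psi> x, x) = f (lift (grng H h))"
            using f_src[OF lift_arrows[OF h(1)]] lift_src[OF h(1)] u by simp_all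
          then have "y \<in> Z" "x \<in> Z" unfolding Z_def using Yh(2,3)[OF h(1)] by (metis fst_conv imageI)+
          moreover have "g \<in> B" using h(2) u unfolding \<theta>_eq pr_def by simp
          moreover have "(x, g, y) \<in> M"
            using arr[unfolded blow_up_arrows] unfolding M_def pr_def arrows_def by simp
          ultimately have "f (lift h) \<in> M \<inter> (Z \<times> B \<times> Z)" using u by simp
          then have "pr' (f' (f (lift h))) \<in> pr' ` f' ` (M \<inter> (Z \<times> B \<times> Z))" by (intro imageI)
          moreover have "h = pr' (f' (f (lift h)))"
            unfolding f'f[OF lift_arrows[OF h(1)]] by (simp add: lift_def pr'_def)
          ultimately show "h \<in> pr' ` f' ` (M \<inter> (Z \<times> B \<times> Z))" by simp
        qed
        ultimately show ?thesis by blast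
      qed
    qed
  qed
  show ?thesis
    unfolding H.dad_at_most_iff
  proof (intro allI impI)
    fix A assume A: "compactin (gtop H) A \<and> A \<subseteq> gunits H"
    define \<O> where "\<O> = {W. openin (unit_space H) W \<and>
      (\<exists>\<sigma>. continuous_map (subtopology (unit_space H) W) Y \<sigma> \<and> (\<forall>w\<in>W. \<phi> (\<sigma> w) = w))}"
    have op: "openin (subtopology (gtop H) A) (A \<inter> W)" if "W \<in> \<O>" for W
      using that A unfolding \<O>_def by (intro H.openin_unit_space_trace) auto
    have cov: "A \<subseteq> \<Union>\<O>"
    proof
      fix a assume "a \<in> A"
      then have "a \<in> topspace (unit_space H)"
        using A H.units_arrows unfolding unit_space_def arrows_def by auto
      then obtain W \<sigma> where "openin (unit_space H) W" "a \<in> W"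
        "continuous_map (subtopology (unit_space H) W) Y \<sigma>" "\<And>w. w \<in> W \<Longrightarrow> \<phi> (\<sigma> w) = w"
        using local_homeomorphism_local_section[OF \<phi>] by blast
      then show "a \<in> \<Union>\<O>" unfolding \<O>_def by blast
    qed
    obtain \<C> where C: "finite \<C>" "\<Union>\<C> = A" "\<And>C. C \<in> \<C> \<Longrightarrow> compactin (gtop H) C \<and> (\<exists>W\<in>\<O>. C \<subseteq> W)"
      by (rule compactin_open_cover_compact_refinement[OF H.Hausdorff conjunct1[OF A] op cov]) blast+
    have "dad_over H (\<Union>\<C>) d"
    proof (rule H.dad_over_Union[OF C(1)])
      fix C assume c: "C \<in> \<C>"
      then obtain W \<sigma> where W: "C \<subseteq> W" "openin (unit_space H) W"
        "continuous_map (subtopology (unit_space H) W) Y \<sigma>" "\<forall>w\<in>W. \<phi> (\<sigma> w) = w"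
        using C(3)[OF c] unfolding \<O>_def by blast
      have "dad_over H C d"
        by (rule local[OF conjunct1[OF C(3)[OF c]] W(1,2,3)]) (use W(4) in blast)
      moreover have "C \<subseteq> gunits H" using c C(2) A by blast
      ultimately show "compactin (gtop H) C \<and> C \<subseteq> gunits H \<and> dad_over H C d" using C(3)[OF c] by blast
    qed
    then show "dad_over H A d" unfolding C(2) .
  qed
qed

lemma dad_morita:
  fixes G :: "'a groupoid_data" and H :: "'b groupoid_data"
  assumes G: "etale_groupoid G" and H: "etale_groupoid H"
    and morita: "morita_equivalent TYPE('x) TYPE('y) G H"
  shows "dad G = dad H"
proof -
  interpret G: etale_groupoid G by fact
  interpret H: etale_groupoid H by fact
  obtain X :: "'x topology" and Y :: "'y topology" and \<psi> \<phi> f where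
    \<psi>: "surjective_local_homeomorphism X (unit_space G) \<psi>"
    and \<phi>: "surjective_local_homeomorphism Y (unit_space H) \<phi>"
    and f: "topological_groupoid_iso (blow_up G X \<psi>) (blow_up H Y \<phi>) f"
    using morita unfolding morita_equivalent_def by blast
  obtain f' where inv: "homeomorphic_maps (gtop (blow_up G X \<psi>)) (gtop (blow_up H Y \<phi>)) f f'"
    using f homeomorphic_map_maps unfolding topological_groupoid_iso_def by blast
  have "\<psi> ` topspace X \<subseteq> gunits G"
    using \<psi> unfolding surjective_local_homeomorphism_def unit_space_def by auto
  note closed = blow_up_closed[OF G.topological_groupoid_axioms this]
  have f': "topological_groupoid_iso (blow_up H Y \<phi>) (blow_up G X \<psi>) f'"
    by (rule topological_groupoid_iso_inverse[OF f inv closed])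
  have cont: "continuous_map X (unit_space G) \<psi>" "continuous_map Y (unit_space H) \<phi>"
    using \<psi> \<phi> local_homeomorphism_continuous unfolding surjective_local_homeomorphism_def by blast+
  have inv': "homeomorphic_maps (gtop (blow_up H Y \<phi>)) (gtop (blow_up G X \<psi>)) f' f"
    using inv homeomorphic_maps_sym by blast
  show ?thesis
  proof (rule enat_eqI_le)
    show "dad G \<le> enat d \<longleftrightarrow> dad H \<le> enat d" for d
      unfolding dad_le_iff
      using dad_at_most_blow_up_transfer[OF G H cont(1) \<phi> inv' f', of d]
        dad_at_most_blow_up_transfer[OF H G cont(2) \<psi> inv f, of d] by blast
  qed
qed

theorem theorem1:
  fixes G :: "'a groupoid_data" and H :: "'b groupoid_data"
  assumes "etale_groupoid G" and "etale_groupoid H"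
  shows "(morita_equivalent TYPE('x) TYPE('y) G H \<longrightarrow> dad G = dad H) \<and>
    (\<forall>\<U>. finite \<U> \<and> (\<forall>U\<in>\<U>. openin (unit_space G) U) \<and> \<Union>\<U> = gunits G \<longrightarrow>
       dad G = (SUP U\<in>\<U>. dad (restriction G U))) \<and>
    dad (product_groupoid G H) \<le> dad G + dad H"
proof (intro conjI impI allI)
  show "dad G = dad H" if "morita_equivalent TYPE('x) TYPE('y) G H"
    using dad_morita[OF assms that] .
  show "dad G = (SUP U\<in>\<U>. dad (restriction G U))"
    if "finite \<U> \<and> (\<forall>U\<in>\<U>. openin (unit_space G) U) \<and> \<Union>\<U> = gunits G" for \<U>
    using that by (intro dad_open_cover[OF assms(1)]) blast+
  show "dad (product_groupoid G H) \<le> dad G + dad H"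
    using dad_product[OF assms] .
qed

end
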